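(* Let $p\ge3$ be odd, let $\Omega\subset\mathbb{R}^2$ be a bounded polygonal domain, and let $\mathcal{T}$ be a regular triangulation of $\Omega$ such that every $K\in\mathcal{T}$ has an inner vertex. Let $\mathbf{z}\in\mathcal{V}_\Omega$. Then the functions $1_{\mathbf{z}}$ and $q_{p-1,\mathbf{z}'}$, $\mathbf{z}'\in\mathcal{C}_{\mathbf{z}}$, are linearly independent and belong to $N_{p,\mathbf{z}}$. If the dimension formula $\dim N_{p,\mathbf{z}}=1+\sigma_{\mathbf{z}}$ holds, where $\sigma_{\mathbf{z}}=|\mathcal{C}_{\mathbf{z}}|$, then they form a basis of $N_{p,\mathbf{z}}$.
   Context: A regular triangulation $\mathcal{T}$ of $\Omega$ is a finite set of closed (nondegenerate) triangles such that the intersection of two different triangles is either empty, a common edge, or a common point (vertex), and $\Omega$ is the interior of $\bigcup_{K\in\mathcal{T}}K$. $\mathcal{E}$ is the set of edges and $\mathcal{V}$ the set of triangle vertices; $\mathcal{V}_\Omega$ is the set of inner vertices, i.e. vertices not on $\partial\Omega$. For $\mathbf{z}\in\mathcal{V}_\Omega$: $\mathcal{T}_{\mathbf{z}}=\{K\in\mathcal{T}:\mathbf{z}\in K\}$, $\omega_{\mathbf{z}}=\bigcup_{K\in\mathcal{T}_{\mathbf{z}}}K$, $\mathcal{E}_{\mathbf{z}}=\{E\in\mathcal{E}:E\subset\omega_{\mathbf{z}}\}$, $\mathcal{V}_{\mathbf{z}}=\{\mathbf{z}'\in\mathcal{V}:\mathbf{z}'\in\omega_{\mathbf{z}}\}$.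 Critical points: $\mathbf{z}'\in\mathcal{V}_{\mathbf{z}}$ is a critical point for $\mathcal{T}_{\mathbf{z}}$ if there exist two straight infinite lines $L_1,L_2$ in $\mathbb{R}^2$ such that all edges $E\in\mathcal{E}_{\mathbf{z}}$ having $\mathbf{z}'$ as an endpoint satisfy $E\subset L_1\cup L_2$. $\mathcal{C}_{\mathbf{z}}$ is the set of all critical points for $\mathcal{T}_{\mathbf{z}}$. Spaces: $\mathbb{P}_{p-1}(\mathcal{T}_{\mathbf{z}})$ is the space of functions in $L^2(\omega_{\mathbf{z}})$ which are polynomials of total degree $\le p-1$ on each $K\in\mathcal{T}_{\mathbf{z}}$. $S_{p,0}(\mathcal{T}_{\mathbf{z}})$ is the space of continuous functions on $\omega_{\mathbf{z}}$ which vanish on $\partial\omega_{\mathbf{z}}$ and are polynomials of total degree $\le p$ on each $K\in\mathcal{T}_{\mathbf{z}}$; $\mathbf{S}_{p,0}(\mathcal{T}_{\mathbf{z}})=S_{p,0}(\mathcal{T}_{\mathbf{z}})^2$. Define $$N_{p,\mathbf{z}}=\{q\in\mathbb{P}_{p-1}(\mathcal{T}_{\mathbf{z}}):\ (q,\operatorname{div}\mathbf{v})_{L^2(\omega_{\mathbf{z}})}=0\ \ \forall\mathbf{v}\in\mathbf{S}_{p,0}(\mathcal{T}_{\mathbf{z}})\}.$$ $1_{\mathbf{z}}$ is the constant function $1$ on $\omega_{\mathbf{z}}$. Critical functions: fix a (non-unique) sign function $\sigma:\mathcal{T}_{\mathbf{z}}\to\{-1,1\}$, $K\mapsto\sigma_K$,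 by the condition that $\sigma_K=-\sigma_{K'}$ whenever two different triangles $K,K'\in\mathcal{T}_{\mathbf{z}}$ share an edge. For $\mathbf{z}'\in\mathcal{C}_{\mathbf{z}}$, $$q_{p-1,\mathbf{z}'}=\begin{cases}\dfrac{\sigma_K}{|K|}\,P_{p-1}^{(0,2)}(1-2\lambda_{K,\mathbf{z}'})&\text{on }K\in\mathcal{T}_{\mathbf{z}}\text{ with }\mathbf{z}'\in K,\\[1ex]0&\text{otherwise,}\end{cases}$$ where $|K|$ is the area of $K$, $\lambda_{K,\mathbf{z}'}$ is the barycentric coordinate of $K$ for the vertex $\mathbf{z}'$ (the affine function equal to $1$ at $\mathbf{z}'$ and $0$ at the other two vertices of $K$), and $P_n^{(\alpha,\beta)}$ ($\alpha,\beta>-1$) is the Jacobi polynomial: the polynomial of degree $n$ with $\int_{-1}^1P_n^{(\alpha,\beta)}(x)q(x)(1-x)^\alpha(1+x)^\beta dx=0$ for all polynomials $q$ of degree less than $n$ and $P_n^{(\alpha,\beta)}(1)=\frac{(\alpha+1)(\alpha+2)\cdots(\alpha+n)}{n!}$. *)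

theory Defs
  imports "HOL-Analysis.Analysis" "HOL-Library.Function_Algebras"
    "HOL-Computational_Algebra.Polynomial"
begin

section \<open>Triangulations and patches\<close>

definition polygonal_domain :: "(real^2) set \<Rightarrow> bool" where
  "polygonal_domain \<Omega> \<longleftrightarrow> open \<Omega> \<and> connected \<Omega> \<and> \<Omega> \<noteq> {} \<and>
     (\<exists>S. finite S \<and> frontier \<Omega> = (\<Union>(a, b)\<in>S. closed_segment a b))"

text \<open>Triangles are represented as point sets. Their vertices are the extreme points,
  and their edges are the one-dimensional faces.\<close>

definition regular_triangulation :: "(real^2) set set \<Rightarrow> (real^2) set \<Rightarrow> bool" where
  "regular_triangulation \<T> \<Omega> \<longleftrightarrow>
     finite \<T> \<and> (\<forall>K\<in>\<T>. 2 simplex K) \<and>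
     (\<forall>K\<in>\<T>. \<forall>K'\<in>\<T>. K \<noteq> K' \<longrightarrow>
        K \<inter> K' = {} \<or>
        (K \<inter> K') edge_of K \<and> (K \<inter> K') edge_of K' \<or>
        (\<exists>x. K \<inter> K' = {x} \<and> x extreme_point_of K \<and> x extreme_point_of K')) \<and>
     \<Omega> = interior (\<Union>\<T>)"

definition edges :: "(real^2) set set \<Rightarrow> (real^2) set set" where
  "edges \<T> = {E. \<exists>K\<in>\<T>. E edge_of K}"

definition vertices :: "(real^2) set set \<Rightarrow> (real^2) set" where
  "vertices \<T> = {x. \<exists>K\<in>\<T>. x extreme_point_of K}"

definition inner_vertices :: "(real^2) set set \<Rightarrow> (real^2) set \<Rightarrow> (real^2) set" where
  "inner_vertices \<T> \<Omega> = {x \<in> vertices \<T>. x \<notin> frontier \<Omega>}"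

definition patch :: "(real^2) set set \<Rightarrow> real^2 \<Rightarrow> (real^2) set set" where
  "patch \<T> z = {K \<in> \<T>. z \<in> K}"

definition patch_region :: "(real^2) set set \<Rightarrow> real^2 \<Rightarrow> (real^2) set" where
  "patch_region \<T> z = \<Union>(patch \<T> z)"

definition patch_edges :: "(real^2) set set \<Rightarrow> real^2 \<Rightarrow> (real^2) set set" where
  "patch_edges \<T> z = {E \<in> edges \<T>. E \<subseteq> patch_region \<T> z}"

definition patch_vertices :: "(real^2) set set \<Rightarrow> real^2 \<Rightarrow> (real^2) set" where
  "patch_vertices \<T> z = {z' \<in> vertices \<T>. z' \<in> patch_region \<T> z}"

definition straight_line :: "(real^2) set \<Rightarrow> bool" where
  "straight_line L \<longleftrightarrow> affine L \<and> aff_dim L = 1"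

definition critical_points :: "(real^2) set set \<Rightarrow> real^2 \<Rightarrow> (real^2) set" where
  "critical_points \<T> z = {z' \<in> patch_vertices \<T> z.
     \<exists>L\<^sub>1 L\<^sub>2. straight_line L\<^sub>1 \<and> straight_line L\<^sub>2 \<and>
       (\<forall>E\<in>patch_edges \<T> z. z' extreme_point_of E \<longrightarrow> E \<subseteq> L\<^sub>1 \<union> L\<^sub>2)}"

section \<open>Piecewise polynomial spaces\<close>

definition poly2_le :: "nat \<Rightarrow> (real^2 \<Rightarrow> real) set" where
  "poly2_le k = {f. \<exists>a :: nat \<Rightarrow> nat \<Rightarrow> real.
     \<forall>x. f x = (\<Sum>i\<le>k. \<Sum>j\<le>k - i. a i j * (x $ 1) ^ i * (x $ 2) ^ j)}"

text \<open>The elements of the discontinuous space are classes of functions modulo null sets.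
  Each class contains exactly one function that is polynomial on the interior of every
  triangle and zero everywhere else (the triangle boundaries form a null set). This
  function represents the class, so linear independence, span and dimension of sets of
  representatives are those in \<open>L\<^sup>2\<close>.\<close>

definition pw_poly :: "(real^2) set set \<Rightarrow> real^2 \<Rightarrow> nat \<Rightarrow> (real^2 \<Rightarrow> real) set" where
  "pw_poly \<T> z k = {q.
     (\<forall>K\<in>patch \<T> z. \<exists>f\<in>poly2_le k. \<forall>x\<in>interior K. q x = f x) \<and>
     (\<forall>x. x \<notin> (\<Union>K\<in>patch \<T> z. interior K) \<longrightarrow> q x = 0)}"

definition one_patch :: "(real^2) set set \<Rightarrow> real^2 \<Rightarrow> real^2 \<Rightarrow> real" where
  "one_patch \<T> z = indicator (\<Union>K\<in>patch \<T> z. interior K)"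

text \<open>Values outside the patch region are irrelevant and left unconstrained.\<close>

definition cont_pw_poly0 :: "(real^2) set set \<Rightarrow> real^2 \<Rightarrow> nat \<Rightarrow> (real^2 \<Rightarrow> real) set" where
  "cont_pw_poly0 \<T> z k = {u.
     continuous_on (patch_region \<T> z) u \<and>
     (\<forall>x\<in>frontier (patch_region \<T> z). u x = 0) \<and>
     (\<forall>K\<in>patch \<T> z. \<exists>f\<in>poly2_le k. \<forall>x\<in>K. u x = f x)}"

definition vec_cont_pw_poly0 ::
    "(real^2) set set \<Rightarrow> real^2 \<Rightarrow> nat \<Rightarrow> (real^2 \<Rightarrow> real^2) set" where
  "vec_cont_pw_poly0 \<T> z k = {v. \<forall>i. (\<lambda>x. v x $ i) \<in> cont_pw_poly0 \<T> z k}"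

text \<open>For continuous piecewise polynomial fields the classical divergence exists off the
  edges and agrees almost everywhere with the weak divergence.\<close>

definition divergence :: "(real^2 \<Rightarrow> real^2) \<Rightarrow> real^2 \<Rightarrow> real" where
  "divergence v x = (\<Sum>i\<in>UNIV. frechet_derivative v (at x) (axis i 1) $ i)"

definition N_space :: "(real^2) set set \<Rightarrow> real^2 \<Rightarrow> nat \<Rightarrow> (real^2 \<Rightarrow> real) set" where
  "N_space \<T> z p = {q \<in> pw_poly \<T> z (p - 1).
     \<forall>v\<in>vec_cont_pw_poly0 \<T> z p.
       (LINT x:patch_region \<T> z|lebesgue. q x * divergence v x) = 0}"

interpretation fun_vs: vector_space "\<lambda>(c::real) (f::real^2 \<Rightarrow> real) x. c * f x"
  by unfold_locales (auto simp: fun_eq_iff algebra_simps)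

section \<open>Critical functions\<close>

definition jacobi_poly :: "nat \<Rightarrow> real \<Rightarrow> real \<Rightarrow> real poly" where
  "jacobi_poly n \<alpha> \<beta> = (THE P. degree P = n \<and>
     (\<forall>q. degree q < n \<longrightarrow>
        (LINT x:{-1..1}|lebesgue.
           poly P x * poly q x * (1 - x) powr \<alpha> * (1 + x) powr \<beta>) = 0) \<and>
     poly P 1 = (\<Prod>k=1..n. \<alpha> + real k) / fact n)"

definition barycentric :: "(real^2) set \<Rightarrow> real^2 \<Rightarrow> real^2 \<Rightarrow> real" where
  "barycentric K y = (THE f. (\<exists>w c. \<forall>x. f x = w \<bullet> x + c) \<and> f y = 1 \<and>
     (\<forall>y'. y' extreme_point_of K \<and> y' \<noteq> y \<longrightarrow> f y' = 0))"

definition sign_function :: "(real^2) set set \<Rightarrow> ((real^2) set \<Rightarrow> real) \<Rightarrow> bool" where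
  "sign_function \<S> \<sigma> \<longleftrightarrow> (\<forall>K\<in>\<S>. \<sigma> K \<in> {-1, 1}) \<and>
     (\<forall>K\<in>\<S>. \<forall>K'\<in>\<S>. K \<noteq> K' \<and> (\<exists>E. E edge_of K \<and> E edge_of K') \<longrightarrow> \<sigma> K = - \<sigma> K')"

text \<open>Around an inner vertex with an odd number of triangles no sign function exists on the
  whole patch. The critical function of a point only involves the signs of the triangles
  containing that point, so the sign condition is imposed only on those triangles; this is
  always satisfiable, and it is implied by the condition on the whole patch.\<close>

definition admissible_signs ::
    "(real^2) set set \<Rightarrow> real^2 \<Rightarrow> ((real^2) set \<Rightarrow> real) \<Rightarrow> bool" where
  "admissible_signs \<T> z \<sigma> \<longleftrightarrow> (\<forall>K\<in>patch \<T> z. \<sigma> K \<in> {-1, 1}) \<and>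
     (\<forall>z'\<in>critical_points \<T> z. sign_function {K \<in> patch \<T> z. z' \<in> K} \<sigma>)"

lemma sign_function_imp_admissible_signs:
  "sign_function (patch \<T> z) \<sigma> \<Longrightarrow> admissible_signs \<T> z \<sigma>"
  unfolding sign_function_def admissible_signs_def by blast

text \<open>The summands have disjoint supports, so this is the definition by cases on triangles.\<close>

definition critical_fun ::
    "(real^2) set set \<Rightarrow> real^2 \<Rightarrow> ((real^2) set \<Rightarrow> real) \<Rightarrow> nat \<Rightarrow> real^2 \<Rightarrow> real^2 \<Rightarrow> real" where
  "critical_fun \<T> z \<sigma> n z' x = (\<Sum>K\<in>{K \<in> patch \<T> z. z' \<in> K}.
     indicator (interior K) x *
       (\<sigma> K / measure lebesgue K * poly (jacobi_poly n 0 2) (1 - 2 * barycentric K z' x)))"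

end

theory Submission
  imports Defs
begin

text \<open>Throughout, \<open>P = P\<^sub>n\<close> with \<open>n = p - 1\<close> denotes the Jacobi polynomial with parameters \<open>(0, 2)\<close>, and \<open>v\<close> a
  continuous piecewise polynomial field that vanishes on the boundary of the patch.

  The constant function is orthogonal to all divergences because the total flux of \<open>v\<close> out of the
  triangles is zero (\<open>sum_integral_divergence\<close>): the contributions of an edge between two triangles
  cancel, and an edge of only one triangle lies on the boundary of the patch.

  For the critical functions, the key is that \<open>P(1 - 2 \<lambda>)\<close>, with \<open>\<lambda>\<close> the barycentric coordinate of a
  vertex \<open>y\<close> of \<open>K\<close>, represents evaluation at \<open>y\<close>: its integral over \<open>K\<close> against a polynomial \<open>h\<close> of degree at
  most \<open>n\<close> is \<open>h y\<close> times the area of \<open>K\<close> times a constant depending on \<open>n\<close> only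
  (\<open>jacobi_point_evaluation\<close>). Indeed, on a ray from \<open>y\<close> one has to integrate \<open>r P(2 r - 1) h\<close>; the part of \<open>h\<close>
  that vanishes at \<open>y\<close> has another factor \<open>r\<close>, and \<open>r\<^sup>2\<close> is the weight for which \<open>P\<close> is orthogonal to lower
  degrees. Hence the critical function of \<open>y\<close> pairs with the divergence of \<open>v\<close> to a multiple of the
  sum of \<open>\<sigma> K\<close> times the divergence at \<open>y\<close> of the piece of \<open>v\<close> on \<open>K\<close>, over the triangles \<open>K\<close> at \<open>y\<close>.
  That sum is zero (\<open>alternating_divergence_vanishes\<close>): all edges at \<open>y\<close> lie on two lines, every triangle
  at \<open>y\<close> has one edge on each, and the derivative of a piece along such an edge depends on \<open>v\<close> on the edge
  only. So triangles sharing the edge have equal derivatives along it and opposite signs,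
  and along a boundary edge the derivative is zero. The alternating sum of the Jacobian matrices
  thus annihilates two independent directions.

  A linear relation between the functions is examined on one triangle at a time. On an edge with end
  points \<open>u\<close> and \<open>v\<close> it is a relation between \<open>P(2 t - 1)\<close>, \<open>P(1 - 2 t)\<close> and a constant. As \<open>n\<close> is even
  and positive, comparing leading coefficients shows that the coefficients of \<open>u\<close> and \<open>v\<close> add up to
  zero; for the three edges of the triangle this forces all coefficients to vanish
  (\<open>jacobi_shapes_independent_on_triangle\<close>). Finally, a subspace whose dimension is the positive number
  of elements of an independent subset is spanned by that subset (\<open>span_eq_of_card_dim\<close>).\<close>

section \<open>Integration over a triangle in polar coordinates\<close>

definition cross2 :: "real^2 \<Rightarrow> real^2 \<Rightarrow> real" where
  "cross2 u v = u$1 * v$2 - u$2 * v$1"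

lemma vec2_eq_iff: "(x::real^2) = y \<longleftrightarrow> x$1 = y$1 \<and> x$2 = y$2"
  by (simp add: vec_eq_iff forall_2)

lemma exists_2_iff: "(\<exists>i::2. P i) \<longleftrightarrow> P 1 \<or> P 2"
  using forall_2[of "\<lambda>i. \<not> P i"] by blast

lemma triangle_polar_coordinates:
  "convex hull {a, b, c} = {a + r *\<^sub>R ((b - a) + s *\<^sub>R (c - b)) | r s. 0 \<le> r \<and> r \<le> 1 \<and> 0 \<le> s \<and> s \<le> (1::real)}"
  for a b c :: "'a::real_vector"
proof (intro equalityI subsetI)
  fix x assume "x \<in> convex hull {a, b, c}"
  then obtain u v w where *: "0 \<le> u" "0 \<le> v" "0 \<le> w" "u + v + w = 1"
      "x = u *\<^sub>R a + v *\<^sub>R b + w *\<^sub>R c"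
    unfolding convex_hull_3 by blast
  show "x \<in> {a + r *\<^sub>R ((b - a) + s *\<^sub>R (c - b)) | r s. 0 \<le> r \<and> r \<le> 1 \<and> 0 \<le> s \<and> s \<le> (1::real)}"
  proof (cases "v + w = 0")
    case True
    with * have "u = 1" "v = 0" "w = 0" by linarith+
    then have "x = a + 0 *\<^sub>R ((b - a) + 0 *\<^sub>R (c - b))" using * by simp
    then show ?thesis by force
  next
    case False
    have e: "u = 1 - (v + w)" using * by simp
    have "(v + w) *\<^sub>R (w / (v + w)) *\<^sub>R (c - b) = w *\<^sub>R (c - b)" using False by simp
    then have "x = a + (v + w) *\<^sub>R ((b - a) + (w / (v + w)) *\<^sub>R (c - b))"
      unfolding *(5) e scaleR_add_right[of "v + w"] by (simp add: algebra_simps)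
    moreover have "0 \<le> w / (v + w)" "w / (v + w) \<le> 1" "0 \<le> v + w" "v + w \<le> 1"
      using * False by (auto simp: divide_simps)
    ultimately show ?thesis by blast
  qed
next
  fix x assume "x \<in> {a + r *\<^sub>R ((b - a) + s *\<^sub>R (c - b)) | r s. 0 \<le> r \<and> r \<le> 1 \<and> 0 \<le> s \<and> s \<le> (1::real)}"
  then obtain r s where *: "0 \<le> r" "r \<le> 1" "0 \<le> s" "s \<le> (1::real)" "x = a + r *\<^sub>R ((b - a) + s *\<^sub>R (c - b))" by blast
  have "x = (1 - r) *\<^sub>R a + (r * (1 - s)) *\<^sub>R b + (r * s) *\<^sub>R c"
    unfolding *(5) by (simp add: algebra_simps)
  moreover have "0 \<le> 1 - r" "0 \<le> r * (1 - s)" "0 \<le> r * s" "(1 - r) + r * (1 - s) + r * s = 1"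
    using * by (auto simp: algebra_simps mult_left_le)
  ultimately show "x \<in> convex hull {a, b, c}" unfolding convex_hull_3 by blast
qed

text \<open>Fubini's theorem is stated for products, and \<open>real^2\<close> is not one; the square is transported
  along the measure-preserving coordinate map.\<close>

lemma integral_unit_square:
  fixes f :: "real^2 \<Rightarrow> real"
  assumes "continuous_on UNIV f"
  shows "integral (cbox 0 1) f = integral {0..1} (\<lambda>s. integral {0..1} (\<lambda>r. f (vector [r, s])))"
proof -
  let ?h = "\<lambda>z::real\<times>real. vector [fst z, snd z] :: real^2"
  let ?g = "\<lambda>x::real^2. (x$1, x$2)"
  have h_alt: "?h = (\<lambda>z. \<chi> i. if i = 1 then fst z else snd z)"
    by (auto simp: vec2_eq_iff fun_eq_iff)
  have "continuous_on UNIV ?h"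
    unfolding h_alt
  proof (rule continuous_on_vec_lambda)
    show "continuous_on UNIV (\<lambda>z::real\<times>real. if i = 1 then fst z else snd z)" for i :: 2
      by (cases "i = 1") (auto intro!: continuous_intros)
  qed
  then have cont: "continuous_on UNIV (\<lambda>z. f (?h z))"
    using continuous_on_compose2[OF assms] by blast
  have h_image: "?h ` cbox u v = cbox (?h u) (?h v)" for u v
  proof (intro equalityI subsetI)
    fix x assume "x \<in> cbox (?h u) (?h v)"
    then have "(x$1, x$2) \<in> cbox u v" by (cases u; cases v) (auto simp: mem_box_cart forall_2)
    moreover have "x = ?h (x$1, x$2)" by (simp add: vec2_eq_iff)
    ultimately show "x \<in> ?h ` cbox u v" by blast
  qed (cases u; cases v, auto simp: mem_box_cart forall_2)
  have g_image: "?g ` cbox u v = cbox (?g u) (?g v)" for u v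
  proof (intro equalityI subsetI)
    fix z assume "z \<in> cbox (?g u) (?g v)"
    then have "?h z \<in> cbox u v" by (cases z) (auto simp: mem_box_cart forall_2)
    moreover have "z = ?g (?h z)" by simp
    ultimately show "z \<in> ?g ` cbox u v" by blast
  qed (auto simp: mem_box_cart forall_2)
  have content: "measure lborel (?g ` cbox u v) = 1 * measure lborel (cbox u v)" for u v
  proof -
    have "cbox u v = {} \<longleftrightarrow> v$1 < u$1 \<or> v$2 < u$2"
      by (simp add: interval_eq_empty_cart exists_2_iff)
    then show ?thesis
      unfolding g_image content_Pair by (auto simp: content_cbox_if_cart UNIV_2 content_real_if)
  qed
  have "((\<lambda>z. f (?h z)) has_integral integral (cbox (0,0) (1,1)) (\<lambda>z. f (?h z))) (cbox (0,0) (1,1))"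
    by (intro integrable_integral integrable_continuous continuous_on_subset[OF cont]) auto
  then have "((\<lambda>x. f (?h (?g x))) has_integral (1/1) *\<^sub>R integral (cbox (0,0) (1,1)) (\<lambda>z. f (?h z))) (?h ` cbox (0,0) (1,1))"
    by (intro has_integral_twiddle) (use content in \<open>auto simp: vec2_eq_iff h_image g_image intro!: continuous_intros\<close>)
  moreover have "?h (?g x) = x" for x by (simp add: vec2_eq_iff)
  moreover have "?h (0,0) = 0" "?h (1,1) = 1" by (simp_all add: vec2_eq_iff)
  ultimately have "(f has_integral integral (cbox (0,0) (1,1)) (\<lambda>z. f (?h z))) (cbox 0 1)"
    by (simp add: h_image)
  then have "integral (cbox 0 1) f = integral (cbox (0,0) (1,1)) (\<lambda>z. f (?h z))"
    by (rule integral_unique)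
  also have "\<dots> = integral (cbox 0 1) (\<lambda>r. integral (cbox 0 1) (\<lambda>s. f (?h (r, s))))"
    by (intro integral_prod_continuous continuous_on_subset[OF cont]) auto
  also have "\<dots> = integral (cbox 0 1) (\<lambda>s. integral (cbox 0 1) (\<lambda>r. f (?h (r, s))))"
    by (intro integral_swap_continuous continuous_on_subset[OF cont])
       (simp add: case_prod_beta continuous_on_subset[OF cont])
  finally show ?thesis by simp
qed

lemma set_integrable_continuous_compact:
  fixes h :: "real^2 \<Rightarrow> real"
  assumes "continuous_on UNIV h" "compact K"
  shows "set_integrable lebesgue K h"
proof -
  obtain u v where "K \<subseteq> cbox u v"
    using bounded_subset_cbox_symmetric[OF compact_imp_bounded[OF assms(2)]] by blast
  then show ?thesis
    by (intro set_integrable_subset[OF absolutely_integrable_continuous[of u v h]])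
       (auto intro: continuous_on_subset[OF assms(1)] simp: lmeasurable_compact assms(2) fmeasurableD)
qed

text \<open>The vertex \<open>a\<close> is the pole: \<open>r\<close> runs from \<open>a\<close> to the opposite edge and \<open>s\<close> runs along that edge.
  The Jacobian is \<open>r\<close> times twice the signed area. In these coordinates both the barycentric
  coordinate of \<open>a\<close>, which is \<open>1 - r\<close>, and differentiation along the edge \<open>bc\<close> become one-dimensional.\<close>

lemma integral_triangle_polar:
  fixes h :: "real^2 \<Rightarrow> real"
  assumes nz: "cross2 (b - a) (c - a) \<noteq> 0" and cont: "continuous_on UNIV h"
  shows "integral (convex hull {a, b, c}) h = \<bar>cross2 (b - a) (c - a)\<bar> *
     integral {0..1} (\<lambda>s. integral {0..1} (\<lambda>r. r * h (a + r *\<^sub>R ((b - a) + s *\<^sub>R (c - b)))))"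
proof -
  let ?K = "convex hull {a, b, c}"
  let ?d = "cross2 (b - a) (c - a)"
  let ?g = "\<lambda>x::real^2. a + x$1 *\<^sub>R ((b - a) + x$2 *\<^sub>R (c - b))"
  let ?g' = "\<lambda>x d::real^2. d$1 *\<^sub>R ((b - a) + x$2 *\<^sub>R (c - b)) + (x$1 * d$2) *\<^sub>R (c - b)"
  let ?S = "{x::real^2. 0 < x$1 \<and> x$1 \<le> 1 \<and> 0 \<le> x$2 \<and> x$2 \<le> 1}"
  let ?D = "\<lambda>x. \<bar>det (matrix (?g' x))\<bar> *\<^sub>R (vec (h (?g x)) :: real^1)"
  \<comment> \<open>The side \<open>r = 0\<close> of the square collapses to the pole and is left out to get injectivity.\<close>
  have S_cbox: "?S \<subseteq> cbox 0 1" "cbox 0 1 - ?S \<subseteq> {x. axis 1 1 \<bullet> x = 0}"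
    by (auto simp: mem_box_cart forall_2 inner_axis')
  have neg: "negligible (cbox 0 1 - ?S)"
    by (rule negligible_subset[OF negligible_hyperplane S_cbox(2)]) simp
  have S_meas: "?S \<in> sets lebesgue"
  proof -
    have eq: "?S = cbox 0 1 - (cbox 0 1 - ?S)" using S_cbox by blast
    have "cbox 0 1 - ?S \<in> null_sets lebesgue" using neg by (simp add: negligible_iff_null_sets)
    then have "cbox 0 1 - ?S \<in> sets lebesgue" by (rule null_setsD2)
    then have "cbox 0 1 - (cbox 0 1 - ?S) \<in> sets lebesgue" by (rule sets.Diff[rotated]) simp
    then show ?thesis by (subst eq)
  qed
  have det: "det (matrix (?g' x)) = x$1 * ?d" for x :: "real^2"
    by (simp add: det_2 matrix_def axis_def cross2_def algebra_simps)
  have der: "(?g has_derivative ?g' x) (at x within ?S)" for x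
    by (auto intro!: derivative_eq_intros bounded_linear_imp_has_derivative[OF bounded_linear_vec_nth] simp: algebra_simps)
  have inj: "inj_on ?g ?S"
  proof (rule inj_onI)
    fix x y assume x: "x \<in> ?S" and y: "y \<in> ?S" and eq: "?g x = ?g y"
    \<comment> \<open>Cross products of \<open>?g w - a\<close> with \<open>c - b\<close> and \<open>b - a\<close> recover \<open>r\<close> and \<open>r * s\<close>.\<close>
    have 1: "(?g w - a)$1 * (c - b)$2 - (?g w - a)$2 * (c - b)$1 = w$1 * ?d" for w
      by (simp add: cross2_def algebra_simps)
    have 2: "(b - a)$1 * (?g w - a)$2 - (b - a)$2 * (?g w - a)$1 = w$1 * w$2 * ?d" for w
      by (simp add: cross2_def algebra_simps)
    have x1: "x$1 = y$1" using 1[of x] 1[of y] nz eq by simp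
    have "x$1 * x$2 * ?d = y$1 * y$2 * ?d" using 2[of x] 2[of y] unfolding eq by linarith
    then have "x$2 = y$2" using nz x x1 by simp
    with x1 show "x = y" by (simp add: vec2_eq_iff)
  qed
  have sub: "?g ` ?S \<subseteq> ?K" "?K - ?g ` ?S \<subseteq> {a}"
  proof -
    show "?g ` ?S \<subseteq> ?K" unfolding triangle_polar_coordinates by fastforce
    have "x = a \<or> x \<in> ?g ` ?S" if "x \<in> ?K" for x
    proof -
      obtain r s where rs: "0 \<le> r" "r \<le> 1" "0 \<le> s" "s \<le> 1" "x = a + r *\<^sub>R ((b - a) + s *\<^sub>R (c - b))"
        using \<open>x \<in> ?K\<close> unfolding triangle_polar_coordinates by blast
      show ?thesis
      proof (cases "r = 0")
        case False
        then have "vector [r, s] \<in> ?S" "?g (vector [r, s]) = x" using rs by auto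
        then show ?thesis by blast
      qed (use rs in simp)
    qed
    then show "?K - ?g ` ?S \<subseteq> {a}" by blast
  qed
  have negK: "negligible (?K - ?g ` ?S)" using sub(2) by (meson negligible_sing negligible_subset)
  have cg: "continuous_on UNIV ?g" by (intro continuous_intros)
  have cD: "continuous_on UNIV (\<lambda>x. x$1 * h (?g x))"
    by (intro continuous_intros continuous_on_compose2[OF cont cg]) auto
  have "(\<lambda>x. \<bar>?d\<bar> * (x$1 * h (?g x))) absolutely_integrable_on cbox 0 1"
    by (intro absolutely_integrable_continuous continuous_intros continuous_on_subset[OF cD]) auto
  then have "(\<lambda>x. \<bar>?d\<bar> * (x$1 * h (?g x))) absolutely_integrable_on ?S"
    by (rule set_integrable_subset) (use S_meas S_cbox in auto)
  then have ai: "(\<lambda>x. \<bar>det (matrix (?g' x))\<bar> * h (?g x)) absolutely_integrable_on ?S"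
    by (rule set_integrable_cong[THEN iffD1, rotated -1]) (auto simp: det abs_mult)
  \<comment> \<open>The change of variables theorem concerns vector-valued functions, hence the detour through \<open>real^1\<close>.\<close>
  have "?D absolutely_integrable_on ?S"
    using absolutely_integrable_linear[OF ai, of "vec :: real \<Rightarrow> real^1"]
    by (simp add: o_def linear_vec linear_linear vec_cmul scalar_mult_eq_scaleR)
  then have "integral (?g ` ?S) (\<lambda>x. vec (h x) :: real^1) = integral ?S ?D"
    "(\<lambda>x. vec (h x) :: real^1) absolutely_integrable_on ?g ` ?S"
    using has_absolute_integral_change_of_variables[OF S_meas der inj, of "\<lambda>x. vec (h x) :: real^1" "integral ?S ?D"]
    by auto
  then have "integral (?g ` ?S) h = integral ?S (\<lambda>x. \<bar>det (matrix (?g' x))\<bar> * h (?g x))"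
    using integral_component_eq_cart[of "\<lambda>x. vec (h x) :: real^1" "?g ` ?S" 1]
      integral_component_eq_cart[of ?D ?S 1] \<open>?D absolutely_integrable_on ?S\<close>
    by (simp add: absolutely_integrable_on_def)
  also have "\<dots> = integral ?S (\<lambda>x. \<bar>?d\<bar> * (x$1 * h (?g x)))"
    by (intro integral_cong) (auto simp: det abs_mult)
  also have "\<dots> = integral (cbox 0 1) (\<lambda>x. \<bar>?d\<bar> * (x$1 * h (?g x)))"
    by (rule integral_subset_negligible[OF S_cbox(1) neg])
  also have "\<dots> = \<bar>?d\<bar> * integral (cbox 0 1) (\<lambda>x. x$1 * h (?g x))" by simp
  also have "integral (?g ` ?S) h = integral ?K h"
    by (rule integral_subset_negligible[OF sub(1) negK])
  finally show ?thesis
    unfolding integral_unit_square[OF cD] by simp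
qed

section \<open>Jacobi polynomials with parameters \<open>(0, 2)\<close>\<close>

text \<open>The inner product for which the polynomials \<open>P\<^sub>n\<close> with parameters \<open>(0, 2)\<close> are orthogonal.\<close>

definition jacobi_inner :: "real poly \<Rightarrow> real poly \<Rightarrow> real" where
  "jacobi_inner P Q = integral {-1..1} (\<lambda>x. poly P x * poly Q x * (1 + x)\<^sup>2)"

lemma jacobi_inner_integrable: "(\<lambda>x. poly P x * poly Q x * (1 + x)\<^sup>2) integrable_on {-1..1::real}"
  by (intro integrable_continuous_real continuous_intros)

text \<open>At the end point \<open>x = 1\<close> the factor \<open>(1 - x) powr 0\<close> is \<open>0 powr 0 = 0\<close>, so the two integrands agree
  only almost everywhere.\<close>

lemma jacobi_weight_integral:
  "(LINT x:{-1..1}|lebesgue. poly P x * poly Q x * (1 - x) powr 0 * (1 + x) powr 2) = jacobi_inner P Q"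
proof -
  have eq: "poly P x * poly Q x * (1 - x) powr 0 * (1 + x) powr 2 = poly P x * poly Q x * (1 + x)\<^sup>2"
    if "x \<in> {-1..1} - {-1, 1}" for x :: real
    using that by (simp add: powr_numeral)
  have "(\<lambda>x. poly P x * poly Q x * (1 + x)\<^sup>2) absolutely_integrable_on {-1..1::real}"
    by (intro absolutely_integrable_continuous_real continuous_intros)
  then have "(\<lambda>x. poly P x * poly Q x * (1 - x) powr 0 * (1 + x) powr 2) absolutely_integrable_on {-1..1::real}"
    by (rule absolutely_integrable_spike[of _ _ "{-1, 1}"]) (use eq in auto)
  then show ?thesis
    unfolding jacobi_inner_def
    by (subst set_lebesgue_integral_eq_integral(2), assumption)
       (rule integral_spike[of "{-1, 1}"], simp, rule eq[symmetric])
qed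

lemma jacobi_inner_diff_left: "jacobi_inner (P - R) Q = jacobi_inner P Q - jacobi_inner R Q"
  unfolding jacobi_inner_def
  by (subst integral_diff[OF jacobi_inner_integrable jacobi_inner_integrable, symmetric]) (simp add: left_diff_distrib)

lemma jacobi_inner_smult_left: "jacobi_inner (smult c P) Q = c * jacobi_inner P Q"
  unfolding jacobi_inner_def by (subst integral_mult_right[symmetric]) (simp add: mult.assoc)

lemma jacobi_inner_commute: "jacobi_inner P Q = jacobi_inner Q P"
  by (simp add: jacobi_inner_def mult.commute)

lemma jacobi_inner_diff_right: "jacobi_inner Q (P - R) = jacobi_inner Q P - jacobi_inner Q R"
  and jacobi_inner_smult_right: "jacobi_inner Q (smult c P) = c * jacobi_inner Q P"
  by (simp_all add: jacobi_inner_commute[of Q] jacobi_inner_diff_left jacobi_inner_smult_left)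

lemma poly_zero_on_interval:
  fixes P :: "real poly"
  assumes "\<And>x. a < x \<Longrightarrow> x < b \<Longrightarrow> poly P x = 0" "a < b"
  shows "P = 0"
proof (rule ccontr)
  assume "P \<noteq> 0"
  then have "finite {x. poly P x = 0}" by (rule poly_roots_finite)
  moreover have "{a<..<b} \<subseteq> {x. poly P x = 0}" using assms by auto
  ultimately show False using assms(2) by (meson finite_subset infinite_Ioo)
qed

lemma jacobi_inner_pos: assumes "P \<noteq> 0" shows "jacobi_inner P P > 0"
proof -
  have c: "continuous_on {-1..1} (\<lambda>x::real. poly P x * poly P x * (1 + x)\<^sup>2)" by (intro continuous_intros)
  have "jacobi_inner P P \<ge> 0" unfolding jacobi_inner_def by (intro integral_nonneg jacobi_inner_integrable) auto
  moreover have "jacobi_inner P P \<noteq> 0"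
  proof
    assume "jacobi_inner P P = 0"
    then have "\<forall>x\<in>{-1..1}. poly P x * poly P x * (1 + x)\<^sup>2 = 0"
      unfolding jacobi_inner_def by (subst (asm) integral_eq_0_iff[OF c]) auto
    then have "P = 0" by (intro poly_zero_on_interval[of "-1" 1]) (auto simp: power2_eq_square)
    with assms show False by simp
  qed
  ultimately show ?thesis by simp
qed

text \<open>One Gram-Schmidt step: the residual of \<open>x ^ n\<close> spans the new direction orthogonal to the
  polynomials of degree less than \<open>n\<close>. Degree bounds are expressed by vanishing coefficients because
  for \<open>n = 0\<close> only the zero polynomial must remain.\<close>

lemma jacobi_inner_projection:
  "\<exists>P. (\<forall>i\<ge>n. coeff P i = 0) \<and> (\<forall>Q. (\<forall>i\<ge>n. coeff Q i = 0) \<longrightarrow> jacobi_inner (f - P) Q = 0)"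
proof (induction n arbitrary: f)
  case 0
  have "jacobi_inner f 0 = 0" by (simp add: jacobi_inner_def)
  moreover have "Q = 0" if "\<forall>i. coeff Q i = 0" for Q :: "real poly" using that by (simp add: poly_eq_iff)
  ultimately show ?case by (intro exI[of _ 0]) auto
next
  case (Suc n)
  obtain P where P: "\<forall>i\<ge>n. coeff P i = 0" "\<And>Q. \<forall>i\<ge>n. coeff Q i = 0 \<Longrightarrow> jacobi_inner (f - P) Q = 0"
    using Suc[of f] by blast
  obtain R where R: "\<forall>i\<ge>n. coeff R i = 0" "\<And>Q. \<forall>i\<ge>n. coeff Q i = 0 \<Longrightarrow> jacobi_inner (monom 1 n - R) Q = 0"
    using Suc[of "monom 1 n"] by blast
  define U where "U = monom 1 n - R"
  have Un: "coeff U n = 1" using R(1) by (simp add: U_def)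
  have "U \<noteq> 0" using Un by auto
  then have pos: "jacobi_inner U U > 0" by (rule jacobi_inner_pos)
  define c where "c = jacobi_inner f U / jacobi_inner U U"
  have low: "jacobi_inner (f - (P + smult c U)) Q = 0" if "\<forall>i\<ge>n. coeff Q i = 0" for Q
    using P(2)[OF that] R(2)[OF that] by (simp add: U_def[symmetric] diff_diff_eq[symmetric] jacobi_inner_diff_left jacobi_inner_smult_left)
  have top: "jacobi_inner (f - (P + smult c U)) U = 0"
  proof -
    have "jacobi_inner U P = 0" using R(2)[OF P(1)] by (simp add: U_def[symmetric])
    then show ?thesis using pos
      by (simp add: diff_diff_eq[symmetric] jacobi_inner_diff_left jacobi_inner_smult_left jacobi_inner_commute[of P] c_def)
  qed
  have "jacobi_inner (f - (P + smult c U)) Q = 0" if Q: "\<forall>i\<ge>Suc n. coeff Q i = 0" for Q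
  proof -
    have "\<forall>i\<ge>n. coeff (Q - smult (coeff Q n) U) i = 0"
    proof (intro allI impI)
      fix i assume "n \<le> i"
      then show "coeff (Q - smult (coeff Q n) U) i = 0"
        using Un Q R(1) by (cases "i = n") (auto simp: U_def)
    qed
    from low[OF this] top show ?thesis by (simp add: jacobi_inner_diff_right jacobi_inner_smult_right)
  qed
  moreover have "\<forall>i\<ge>Suc n. coeff (P + smult c U) i = 0" using P(1) R(1) by (auto simp: U_def)
  ultimately show ?case by blast
qed

text \<open>The residual \<open>U\<close> of \<open>x ^ n\<close> can be normalized to the value \<open>1\<close> at \<open>1\<close>: otherwise \<open>U = (x - 1) Q\<close> with
  \<open>Q\<close> of smaller degree, and orthogonality of \<open>U\<close> and \<open>Q\<close> says that the nonnegative function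
  \<open>(1 - x) Q\<^sup>2 (1 + x)\<^sup>2\<close> has integral zero, which forces \<open>Q = 0\<close>.\<close>

lemma jacobi_inner_orthogonal_exists:
  assumes "n \<ge> 1"
  shows "\<exists>P. degree P = n \<and> (\<forall>Q. degree Q < n \<longrightarrow> jacobi_inner P Q = 0) \<and> poly P 1 = 1"
proof -
  obtain R where R: "\<forall>i\<ge>n. coeff R i = 0" "\<And>Q. \<forall>i\<ge>n. coeff Q i = 0 \<Longrightarrow> jacobi_inner (monom 1 n - R) Q = 0"
    using jacobi_inner_projection[of n "monom 1 n"] by blast
  define U where "U = monom 1 n - R"
  have Un: "coeff U n = 1" using R(1) by (simp add: U_def)
  then have "U \<noteq> 0" by auto
  have deg: "degree U = n"
  proof (rule antisym)
    show "degree U \<le> n" using R(1) by (intro degree_le) (auto simp: U_def)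
    show "n \<le> degree U" using Un by (intro le_degree) simp
  qed
  have orth: "jacobi_inner U Q = 0" if "degree Q < n" for Q
    unfolding U_def using that by (intro R(2)) (auto intro: coeff_eq_0)
  have "poly U 1 \<noteq> 0"
  proof
    assume "poly U 1 = 0"
    then obtain Q where Q: "U = [:-1, 1:] * Q" by (metis dvdE poly_eq_0_iff_dvd)
    then have "Q \<noteq> 0" using \<open>U \<noteq> 0\<close> by auto
    then have "degree Q < n" using deg unfolding Q by (subst (asm) degree_mult_eq) auto
    then have "jacobi_inner U Q = 0" by (rule orth)
    then have z: "integral {-1..1} (\<lambda>x. (1 - x) * (poly Q x * poly Q x * (1 + x)\<^sup>2)) = 0"
      unfolding jacobi_inner_def Q using integral_neg[of "{-1..1}" "\<lambda>x. (1 - x) * (poly Q x * poly Q x * (1 + x)\<^sup>2)"]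
      by (simp add: algebra_simps)
    have cont: "continuous_on {-1..1} (\<lambda>x::real. (1 - x) * (poly Q x * poly Q x * (1 + x)\<^sup>2))"
      by (intro continuous_intros)
    have zero: "\<forall>x\<in>{-1..1}. (1 - x) * (poly Q x * poly Q x * (1 + x)\<^sup>2) = 0"
      by (rule integral_eq_0_iff[OF cont, THEN iffD1, OF _ _ z]) auto
    have "poly Q x = 0" if "-1 < x" "x < 1" for x
      using bspec[OF zero, of x] that by auto
    then have "Q = 0" by (rule poly_zero_on_interval[of "-1" 1]) auto
    then show False using \<open>Q \<noteq> 0\<close> by simp
  qed
  then show ?thesis using deg orth
    by (intro exI[of _ "smult (1 / poly U 1) U"]) (auto simp: jacobi_inner_smult_left)
qed

text \<open>Only uniqueness is left: for two candidates, the combination that cancels the leading terms has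
  degree less than \<open>n\<close> and is orthogonal to itself, so the candidates are proportional, and their
  common value at \<open>1\<close> makes them equal.\<close>

lemma jacobi_poly_0_2:
  assumes "n \<ge> 1"
  shows degree_jacobi: "degree (jacobi_poly n 0 2) = n"
    and jacobi_orthogonal: "\<And>Q. degree Q < n \<Longrightarrow> jacobi_inner (jacobi_poly n 0 2) Q = 0"
proof -
  let ?J = "\<lambda>P. degree P = n \<and> (\<forall>Q. degree Q < n \<longrightarrow> jacobi_inner P Q = 0) \<and> poly P 1 = 1"
  have norm: "(\<Prod>k=1..n. 0 + real k) / fact n = 1" by (simp add: fact_prod)
  have "\<exists>!P. ?J P"
  proof (rule ex_ex1I)
    show "\<exists>P. ?J P" by (rule jacobi_inner_orthogonal_exists[OF assms])
    fix P R assume P: "?J P" and R: "?J R"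
    let ?D = "smult (lead_coeff R) P - smult (lead_coeff P) R"
    have D: "degree ?D < n"
    proof -
      have "degree ?D \<le> n" using P R by (metis degree_diff_le degree_smult_le order_trans)
      moreover have "coeff ?D n = 0" using P R by (simp add: mult.commute)
      ultimately show ?thesis using assms eq_zero_or_degree_less[of ?D n] by fastforce
    qed
    then have "jacobi_inner ?D ?D = 0" using P R by (subst jacobi_inner_diff_left) (simp add: jacobi_inner_smult_left)
    then have "?D = 0" using jacobi_inner_pos[of ?D] by force
    then have *: "smult (lead_coeff R) P = smult (lead_coeff P) R" by simp
    then have "poly (smult (lead_coeff R) P) 1 = poly (smult (lead_coeff P) R) 1" by simp
    then have "lead_coeff R = lead_coeff P" using P R by simp
    moreover have "lead_coeff P \<noteq> 0" using P assms by auto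
    ultimately show "P = R" using * by (auto simp: poly_eq_iff)
  qed
  then have "?J (THE P. ?J P)" by (rule theI')
  then have "?J (jacobi_poly n 0 2)" unfolding jacobi_poly_def jacobi_weight_integral norm .
  then show "degree (jacobi_poly n 0 2) = n" "\<And>Q. degree Q < n \<Longrightarrow> jacobi_inner (jacobi_poly n 0 2) Q = 0"
    by blast+
qed

section \<open>Polynomials of bounded total degree in the plane\<close>

lemma poly2_le_monomial:
  assumes "i + j \<le> k"
  shows "(\<lambda>x. c * (x $ 1) ^ i * (x $ 2) ^ j) \<in> poly2_le k"
proof -
  let ?a = "\<lambda>i' j'. if i' = i \<and> j' = j then c else 0"
  have "c * (x $ 1) ^ i * (x $ 2) ^ j = (\<Sum>i'\<le>k. \<Sum>j'\<le>k - i'. ?a i' j' * (x $ 1) ^ i' * (x $ 2) ^ j')" for x :: "real^2"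
  proof -
    have "(\<Sum>i'\<le>k. \<Sum>j'\<le>k - i'. ?a i' j' * (x $ 1) ^ i' * (x $ 2) ^ j')
        = (\<Sum>i'\<le>k. if i' = i then (\<Sum>j'\<le>k - i. if j' = j then c * (x $ 1) ^ i * (x $ 2) ^ j else 0) else 0)"
    proof (rule sum.cong[OF refl])
      fix i'
      have "(\<Sum>j'\<le>k - i. ?a i j' * (x $ 1) ^ i * (x $ 2) ^ j') = (\<Sum>j'\<le>k - i. if j' = j then c * (x $ 1) ^ i * (x $ 2) ^ j else 0)"
        by (rule sum.cong) auto
      then show "(\<Sum>j'\<le>k - i'. ?a i' j' * (x $ 1) ^ i' * (x $ 2) ^ j') = (if i' = i then (\<Sum>j'\<le>k - i. if j' = j then c * (x $ 1) ^ i * (x $ 2) ^ j else 0) else 0)"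
        by (cases "i' = i") (simp_all only: if_True if_False simp_thms, simp)
    qed
    also have "\<dots> = c * (x $ 1) ^ i * (x $ 2) ^ j" using assms by simp
    finally show ?thesis by (rule sym)
  qed
  then show ?thesis unfolding poly2_le_def by (auto intro!: exI[of _ ?a])
qed

lemma poly2_le_add:
  assumes "f \<in> poly2_le k" "g \<in> poly2_le k" shows "(\<lambda>x. f x + g x) \<in> poly2_le k"
proof -
  obtain a b where "\<And>x. f x = (\<Sum>i\<le>k. \<Sum>j\<le>k - i. a i j * (x $ 1) ^ i * (x $ 2) ^ j)"
     "\<And>x. g x = (\<Sum>i\<le>k. \<Sum>j\<le>k - i. b i j * (x $ 1) ^ i * (x $ 2) ^ j)"
    using assms unfolding poly2_le_def by blast
  then have "\<forall>x. f x + g x = (\<Sum>i\<le>k. \<Sum>j\<le>k - i. (a i j + b i j) * (x $ 1) ^ i * (x $ 2) ^ j)"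
    by (simp add: sum.distrib ring_distribs)
  then show ?thesis unfolding poly2_le_def by (auto intro!: exI[of _ "\<lambda>i j. a i j + b i j"])
qed

lemma poly2_le_cmult:
  assumes "f \<in> poly2_le k" shows "(\<lambda>x. c * f x) \<in> poly2_le k"
proof -
  obtain a where "\<And>x. f x = (\<Sum>i\<le>k. \<Sum>j\<le>k - i. a i j * (x $ 1) ^ i * (x $ 2) ^ j)"
    using assms unfolding poly2_le_def by blast
  then have "\<forall>x. c * f x = (\<Sum>i\<le>k. \<Sum>j\<le>k - i. (c * a i j) * (x $ 1) ^ i * (x $ 2) ^ j)"
    by (simp add: sum_distrib_left mult.assoc)
  then show ?thesis unfolding poly2_le_def by (auto intro!: exI[of _ "\<lambda>i j. c * a i j"])
qed

lemma poly2_le_const: "(\<lambda>x. c) \<in> poly2_le k"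
  using poly2_le_monomial[of 0 0 k c] by simp

lemma poly2_le_induct [consumes 1, case_names monomial add]:
  assumes "f \<in> poly2_le k"
    and mono: "\<And>c i j. i + j \<le> k \<Longrightarrow> P (\<lambda>x. c * (x $ 1) ^ i * (x $ 2) ^ j)"
    and add: "\<And>f g. P f \<Longrightarrow> P g \<Longrightarrow> P (\<lambda>x. f x + g x)"
  shows "P f"
proof -
  have zero: "P (\<lambda>x. 0)" using mono[of 0 0 0] by simp
  have sum: "P (\<lambda>x. \<Sum>i\<in>I. h i x)" if "\<And>i. i \<in> I \<Longrightarrow> P (h i)" for I :: "nat set" and h
    using that by (induction I rule: infinite_finite_induct) (auto intro: zero add)
  obtain a where "f = (\<lambda>x. \<Sum>i\<le>k. \<Sum>j\<le>k - i. a i j * (x $ 1) ^ i * (x $ 2) ^ j)"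
    using assms(1) unfolding poly2_le_def by auto
  then show ?thesis by (simp only:) (intro sum mono, auto)
qed

lemma poly2_le_affine_mult:
  assumes "f \<in> poly2_le k"
  shows "(\<lambda>x. (w \<bullet> x + c) * f x) \<in> poly2_le (Suc k)"
  using assms
proof (induction rule: poly2_le_induct)
  case (monomial d i j)
  have "(\<lambda>x. (w$1 * d) * x$1 ^ Suc i * x$2 ^ j + (w$2 * d) * x$1 ^ i * x$2 ^ Suc j + (c * d) * x$1 ^ i * x$2 ^ j)
     \<in> poly2_le (Suc k)"
    using monomial by (intro poly2_le_add poly2_le_monomial) auto
  also have "(\<lambda>x. (w$1 * d) * x$1 ^ Suc i * x$2 ^ j + (w$2 * d) * x$1 ^ i * x$2 ^ Suc j + (c * d) * x$1 ^ i * x$2 ^ j)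
     = (\<lambda>x. (w \<bullet> x + c) * (d * x $ 1 ^ i * x $ 2 ^ j))"
    by (auto simp: inner_vec_def sum_2 algebra_simps)
  finally show ?case .
next
  case (add f g)
  then show ?case using poly2_le_add by (simp add: ring_distribs)
qed

lemma poly2_le_compose_affine:
  "degree P \<le> k \<Longrightarrow> (\<lambda>x. poly P (w \<bullet> x + c)) \<in> poly2_le k"
proof (induction P arbitrary: k)
  case 0
  then show ?case by (simp add: poly2_le_const)
next
  case (pCons a P)
  show ?case
  proof (cases "P = 0")
    case True
    then show ?thesis by (simp add: poly2_le_const)
  next
    case False
    then obtain l where l: "k = Suc l" "degree P \<le> l" using pCons.prems by (cases k) auto
    show ?thesis using poly2_le_add[OF poly2_le_const[of a] poly2_le_affine_mult[OF pCons.IH[OF l(2)], of w c]]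
      by (simp add: l(1))
  qed
qed

lemma poly2_le_continuous: "f \<in> poly2_le k \<Longrightarrow> continuous_on UNIV f"
  by (induction rule: poly2_le_induct) (auto intro!: continuous_intros)

text \<open>On a line, total degree becomes ordinary degree; this is where the bound on the total degree enters
  the orthogonality argument.\<close>

lemma poly2_le_on_line:
  assumes "f \<in> poly2_le k"
  shows "\<exists>Q. degree Q \<le> k \<and> (\<forall>r. f (a + r *\<^sub>R w) = poly Q r)"
  using assms
proof (induction rule: poly2_le_induct)
  case (monomial c i j)
  let ?Q = "[:c:] * [:a$1, w$1:] ^ i * [:a$2, w$2:] ^ j"
  have "degree ?Q \<le> 0 + i + j"
  proof (intro order_trans[OF degree_mult_le] add_mono)
    have "degree ([:s, t:] ^ i) \<le> i" for s t :: real and i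
      using degree_power_le[of "[:s,t:]" i] by (metis degree_pCons_le degree_pCons_0 mult_le_mono1 mult_1 One_nat_def order_trans degree_0 )
    then show "degree ([:a$1, w$1:] ^ i) \<le> i" "degree ([:a$2, w$2:] ^ j) \<le> j" by auto
  qed auto
  then show ?case using monomial by (intro exI[of _ ?Q]) (auto simp: mult.commute)
next
  case (add f g)
  then obtain Q R where "degree Q \<le> k" "\<And>r. f (a + r *\<^sub>R w) = poly Q r" "degree R \<le> k" "\<And>r. g (a + r *\<^sub>R w) = poly R r"
    by blast
  then show ?case by (intro exI[of _ "Q + R"]) (auto intro: degree_add_le)
qed

lemma poly2_le_derivative:
  assumes "f \<in> poly2_le k"
  shows "\<exists>g1\<in>poly2_le (k - 1). \<exists>g2\<in>poly2_le (k - 1).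
     \<forall>x. (f has_derivative (\<lambda>d. g1 x * d$1 + g2 x * d$2)) (at x)"
  using assms
proof (induction rule: poly2_le_induct)
  case (monomial c i j)
  let ?g1 = "\<lambda>x::real^2. (c * real i) * x$1 ^ (i - 1) * x$2 ^ j"
  let ?g2 = "\<lambda>x::real^2. (c * real j) * x$1 ^ i * x$2 ^ (j - 1)"
  have "?g1 \<in> poly2_le (k - 1)"
    using monomial by (cases "i = 0") (auto intro: poly2_le_const[of 0, simplified] poly2_le_monomial simp del: of_nat_mult)
  moreover have "?g2 \<in> poly2_le (k - 1)"
    using monomial by (cases "j = 0") (auto intro: poly2_le_const[of 0, simplified] poly2_le_monomial)
  moreover have "((\<lambda>x. c * x$1 ^ i * x$2 ^ j) has_derivative (\<lambda>d. ?g1 x * d$1 + ?g2 x * d$2)) (at x)" for x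
    by (auto intro!: derivative_eq_intros bounded_linear_imp_has_derivative[OF bounded_linear_vec_nth]
        simp: algebra_simps)
  ultimately show ?case by (intro bexI[of _ ?g1] bexI[of _ ?g2] allI)
next
  case (add f g)
  then obtain f1 f2 g1 g2 where *: "f1 \<in> poly2_le (k - 1)" "f2 \<in> poly2_le (k - 1)" "g1 \<in> poly2_le (k - 1)" "g2 \<in> poly2_le (k - 1)"
    "\<And>x. (f has_derivative (\<lambda>d. f1 x * d$1 + f2 x * d$2)) (at x)"
    "\<And>x. (g has_derivative (\<lambda>d. g1 x * d$1 + g2 x * d$2)) (at x)" by blast
  have "((\<lambda>x. f x + g x) has_derivative (\<lambda>d. (f1 x + g1 x) * d$1 + (f2 x + g2 x) * d$2)) (at x)" for x
    using has_derivative_add[OF *(5,6)[of x]] by (simp add: algebra_simps)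
  then show ?case using poly2_le_add[OF *(1,3)] poly2_le_add[OF *(2,4)]
    by (intro bexI[of _ "\<lambda>x. f1 x + g1 x"] bexI[of _ "\<lambda>x. f2 x + g2 x"] allI)
qed

section \<open>Point evaluation by a Jacobi polynomial\<close>

lemma has_integral_unit_interval:
  fixes f :: "real \<Rightarrow> real"
  assumes "(f has_integral i) {-1..1}"
  shows "((\<lambda>r. f (2 * r - 1)) has_integral i / 2) {0..1}"
proof -
  have "(\<lambda>x::real. (1/2) *\<^sub>R x + - ((1/2) *\<^sub>R (-1))) ` cbox (-1) 1 = {0..1}"
  proof (intro equalityI subsetI)
    fix y :: real assume "y \<in> {0..1}"
    then show "y \<in> (\<lambda>x::real. (1/2) *\<^sub>R x + - ((1/2) *\<^sub>R (-1))) ` cbox (-1) 1"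
      by (intro image_eqI[of _ _ "2 * y - 1"]) (auto simp: field_simps)
  qed auto
  then show ?thesis
    using has_integral_affinity[of f i "-1" 1 2 "-1"] assms by simp
qed

text \<open>Write \<open>Q = Q(0) + r R\<close> with \<open>R\<close> of degree less than \<open>n\<close>. The second part contributes the integral of
  \<open>P\<^sub>n(2 r - 1) R(r) r\<^sup>2\<close>, which is the inner product of \<open>P\<^sub>n\<close> with a polynomial of degree less than \<open>n\<close>
  after the substitution \<open>x = 2 r - 1\<close>, since \<open>1 + x = 2 r\<close>.\<close>

lemma jacobi_moment:
  assumes n: "n \<ge> 1" and Q: "degree Q \<le> n"
  shows "integral {0..1} (\<lambda>r. r * (poly (jacobi_poly n 0 2) (2 * r - 1) * poly Q r))
    = poly Q 0 * integral {0..1} (\<lambda>r. r * poly (jacobi_poly n 0 2) (2 * r - 1))"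
proof -
  let ?J = "jacobi_poly n 0 2"
  obtain q R where QR: "Q = pCons q R" by (cases Q)
  have R: "degree R < n" using n Q unfolding QR by (auto split: if_splits)
  let ?R = "pcompose R [:1/2, 1/2:]"
  have "jacobi_inner ?J ?R = 0" using R by (intro jacobi_orthogonal[OF n]) (simp add: degree_pcompose)
  then have "((\<lambda>x. poly ?J x * poly ?R x * (1 + x)\<^sup>2) has_integral 0) {-1..1}"
    using jacobi_inner_integrable[of ?J ?R] by (simp add: jacobi_inner_def integrable_integral has_integral_iff)
  from has_integral_unit_interval[OF this]
  have "((\<lambda>r. 4 * (r\<^sup>2 * (poly ?J (2 * r - 1) * poly R r))) has_integral 0) {0..1}"
    by (rule has_integral_eq[rotated, THEN iffD1[OF arg_cong[of _ _ "\<lambda>i. (_ has_integral i) _"], rotated]])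
       (simp_all add: poly_pcompose power2_eq_square algebra_simps add_divide_distrib diff_divide_distrib)
  then have "((\<lambda>r. (1/4) * (4 * (r\<^sup>2 * (poly ?J (2 * r - 1) * poly R r)))) has_integral (1/4) * 0) {0..1}"
    by (rule has_integral_mult_right)
  then have 2: "((\<lambda>r. r\<^sup>2 * (poly ?J (2 * r - 1) * poly R r)) has_integral 0) {0..1}" by simp
  have "(\<lambda>r::real. r * poly ?J (2 * r - 1)) integrable_on {0..1}"
    by (intro integrable_continuous_real continuous_intros)
  then have 1: "((\<lambda>r. q * (r * poly ?J (2 * r - 1))) has_integral q * integral {0..1} (\<lambda>r. r * poly ?J (2 * r - 1))) {0..1}"
    by (intro has_integral_mult_right integrable_integral)
  have "((\<lambda>r. r * (poly ?J (2 * r - 1) * poly Q r)) has_integral q * integral {0..1} (\<lambda>r. r * poly ?J (2 * r - 1))) {0..1}"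
    using has_integral_add[OF 1 2] by (simp add: QR algebra_simps power2_eq_square)
  then show ?thesis by (simp add: QR integral_unique)
qed

lemma measure_triangle:
  assumes nz: "cross2 (b - a) (c - a) \<noteq> 0"
  shows "measure lebesgue (convex hull {a, b, c}) = \<bar>cross2 (b - a) (c - a)\<bar> / 2"
proof -
  have "measure lebesgue (convex hull {a, b, c}) = integral (convex hull {a, b, c}) (\<lambda>x. 1)"
    by (intro lmeasure_integral lmeasurable_compact finite_imp_compact_convex_hull) simp
  also have "\<dots> = \<bar>cross2 (b - a) (c - a)\<bar> / 2"
  proof -
    have "integral {0..1} (\<lambda>r::real. r) = 1 / 2"
      by (rule integral_unique) (use ident_has_integral[of 0 1] in simp)
    then show ?thesis by (subst integral_triangle_polar[OF nz]) auto
  qed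
  finally show ?thesis .
qed

text \<open>The mean value of \<open>P\<^sub>n(1 - 2 \<lambda>)\<close> over a triangle, where \<open>\<lambda>\<close> is the barycentric coordinate of a vertex.\<close>

definition jacobi_mean :: "nat \<Rightarrow> real" where
  "jacobi_mean n = 2 * integral {0..1} (\<lambda>r. r * poly (jacobi_poly n 0 2) (2 * r - 1))"

lemma cross2_polar:
  "cross2 (b - (a + r *\<^sub>R ((b - a) + s *\<^sub>R (c - b)))) (c - (a + r *\<^sub>R ((b - a) + s *\<^sub>R (c - b))))
    = (1 - r) * cross2 (b - a) (c - a)"
  by (simp add: cross2_def algebra_simps)

text \<open>On polynomials of degree at most \<open>n\<close>, integration against \<open>P\<^sub>n(1 - 2 \<lambda>)\<close> is a multiple of evaluation
  at the vertex: in polar coordinates about that vertex the weight \<open>r\<close> of the area element and the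
  moment lemma on each ray leave only the value at the vertex.\<close>

lemma jacobi_point_evaluation:
  assumes nz: "cross2 (b - a) (c - a) \<noteq> 0" and n: "n \<ge> 1" and h: "h \<in> poly2_le n"
  shows "integral (convex hull {a, b, c})
      (\<lambda>x. poly (jacobi_poly n 0 2) (1 - 2 * (cross2 (b - x) (c - x) / cross2 (b - a) (c - a))) * h x)
    = measure lebesgue (convex hull {a, b, c}) * jacobi_mean n * h a"
proof -
  let ?J = "jacobi_poly n 0 2" and ?d = "cross2 (b - a) (c - a)"
  have "continuous_on UNIV (\<lambda>x. cross2 (b - x) (c - x))"
    unfolding cross2_def by (intro continuous_intros)
  then have cont: "continuous_on UNIV (\<lambda>x. poly ?J (1 - 2 * (cross2 (b - x) (c - x) / ?d)) * h x)"
    using poly2_le_continuous[OF h] nz by (intro continuous_intros) auto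
  have inner: "integral {0..1} (\<lambda>r. r * (poly ?J (2 * r - 1) * h (a + r *\<^sub>R ((b - a) + s *\<^sub>R (c - b)))))
     = h a * integral {0..1} (\<lambda>r. r * poly ?J (2 * r - 1))" for s
  proof -
    obtain Q where Q: "degree Q \<le> n" "\<And>r. h (a + r *\<^sub>R ((b - a) + s *\<^sub>R (c - b))) = poly Q r"
      using poly2_le_on_line[OF h] by blast
    have "h a = poly Q 0" using Q(2)[of 0] by simp
    then show ?thesis using jacobi_moment[OF n Q(1)] by (simp add: Q(2))
  qed
  have arg: "1 - 2 * (1 - r) = 2 * r - 1" for r :: real by simp
  show ?thesis
    unfolding integral_triangle_polar[OF nz cont] cross2_polar nonzero_mult_div_cancel_right[OF nz] arg inner
    by (simp add: measure_triangle[OF nz] jacobi_mean_def)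
qed

section \<open>The divergence theorem on a triangle\<close>

definition edge_mean :: "(real^2 \<Rightarrow> real) \<Rightarrow> real^2 \<Rightarrow> real^2 \<Rightarrow> real" where
  "edge_mean f a b = integral {0..1} (\<lambda>t. f (a + t *\<^sub>R (b - a)))"

lemma edge_mean_commute:
  assumes "continuous_on UNIV f"
  shows "edge_mean f a b = edge_mean f b a"
proof -
  let ?g = "\<lambda>t. f (a + t *\<^sub>R (b - a))"
  have "continuous_on UNIV ?g" by (intro continuous_on_compose2[OF assms] continuous_intros) auto
  then have "?g integrable_on {0..1}"
    by (intro integrable_continuous_real) (rule continuous_on_subset, auto)
  then have "(?g has_integral edge_mean f a b) (cbox 0 1)"
    unfolding edge_mean_def by (simp add: integrable_integral)
  from has_integral_affinity[OF this, of "-1" 1]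
  have "((\<lambda>t. ?g (1 - t)) has_integral edge_mean f a b) {0..1}"
    by (simp add: image_affinity_atLeastAtMost)
  moreover have "?g (1 - t) = f (b + t *\<^sub>R (a - b))" for t by (simp add: algebra_simps)
  ultimately show ?thesis by (simp add: edge_mean_def integral_unique)
qed

text \<open>In polar coordinates about \<open>a\<close>, \<open>r\<close> times the derivative in direction \<open>c - b\<close> is the derivative with
  respect to \<open>s\<close>, so the integral over \<open>s\<close> is elementary and only the two edges at \<open>a\<close> remain.\<close>

lemma integral_directional_derivative:
  fixes f :: "real^2 \<Rightarrow> real" and g :: "real^2 \<Rightarrow> real^2"
  assumes nz: "cross2 (b - a) (c - a) \<noteq> 0"
    and der: "\<And>x. (f has_derivative (\<lambda>d. g x \<bullet> d)) (at x)" and cont: "continuous_on UNIV g"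
  shows "integral (convex hull {a, b, c}) (\<lambda>x. g x \<bullet> (c - b))
    = \<bar>cross2 (b - a) (c - a)\<bar> * (edge_mean f a c - edge_mean f a b)"
proof -
  let ?x = "\<lambda>r s. a + r *\<^sub>R ((b - a) + s *\<^sub>R (c - b))"
  have contf: "continuous_on UNIV f"
    using der by (meson continuous_at_imp_continuous_on has_derivative_continuous)
  have cont': "continuous_on UNIV (\<lambda>x. g x \<bullet> (c - b))" by (intro continuous_intros cont)
  have "continuous_on UNIV (\<lambda>z::real\<times>real. snd z * (g (?x (snd z) (fst z)) \<bullet> (c - b)))"
    by (intro continuous_intros continuous_on_compose2[OF cont]) auto
  then have "continuous_on (cbox (0, 0) (1, 1)) (\<lambda>(s, r). r * (g (?x r s) \<bullet> (c - b)))"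
    unfolding case_prod_beta by (rule continuous_on_subset) simp
  from integral_swap_continuous[OF this]
  have swap: "integral {0..1} (\<lambda>s. integral {0..1} (\<lambda>r. r * (g (?x r s) \<bullet> (c - b))))
     = integral {0..1} (\<lambda>r. integral {0..1} (\<lambda>s. r * (g (?x r s) \<bullet> (c - b))))" by simp
  have inner: "integral {0..1} (\<lambda>s. r * (g (?x r s) \<bullet> (c - b))) = f (a + r *\<^sub>R (c - a)) - f (a + r *\<^sub>R (b - a))" for r
  proof -
    have h: "((\<lambda>s. r * (g (?x r s) \<bullet> (c - b))) has_integral f (?x r 1) - f (?x r 0)) {0..1}"
    proof (rule fundamental_theorem_of_calculus)
      fix s :: real
      have "((\<lambda>s. ?x r s) has_derivative (\<lambda>d. r *\<^sub>R d *\<^sub>R (c - b))) (at s within {0..1})"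
        by (auto intro!: derivative_eq_intros)
      from has_derivative_compose[OF this der]
      show "((\<lambda>s. f (?x r s)) has_vector_derivative r * (g (?x r s) \<bullet> (c - b))) (at s within {0..1})"
        by (simp add: has_vector_derivative_def algebra_simps)
    qed simp
    have e: "?x r 1 = a + r *\<^sub>R (c - a)" "?x r 0 = a + r *\<^sub>R (b - a)" by (simp_all add: algebra_simps)
    show ?thesis using integral_unique[OF h] unfolding e .
  qed
  have int: "(\<lambda>r. f (a + r *\<^sub>R w)) integrable_on {0..1}" for w
    by (intro integrable_continuous_real continuous_on_compose2[OF contf] continuous_intros) auto
  show ?thesis
    unfolding integral_triangle_polar[OF nz cont'] swap inner edge_mean_def
    by (simp add: integral_diff int)
qed

text \<open>The flux through the segment from \<open>a\<close> to \<open>b\<close>: the factor \<open>b - a\<close>, rotated clockwise by a right angle,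
  carries both the normal and the length of the segment.\<close>

definition edge_flux :: "(real^2 \<Rightarrow> real^2) \<Rightarrow> real^2 \<Rightarrow> real^2 \<Rightarrow> real" where
  "edge_flux F a b = edge_mean (\<lambda>x. F x $ 1) a b * (b - a)$2 - edge_mean (\<lambda>x. F x $ 2) a b * (b - a)$1"

text \<open>The degree bound is put on the entries of the Jacobian matrix \<open>G\<close> because only the divergence
  is integrated against functions of the constraint space.\<close>

definition polynomial_field :: "nat \<Rightarrow> (real^2 \<Rightarrow> real^2) \<Rightarrow> (real^2 \<Rightarrow> real^2^2) \<Rightarrow> bool" where
  "polynomial_field k F G \<longleftrightarrow> (\<forall>x. (F has_derivative (\<lambda>d. G x *v d)) (at x)) \<and>
     (\<forall>i j. (\<lambda>x. G x $ i $ j) \<in> poly2_le (k - 1))"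

lemma polynomial_field_component:
  assumes "polynomial_field k F G"
  shows "((\<lambda>x. F x $ i) has_derivative (\<lambda>d. G x $ i \<bullet> d)) (at x)"
proof -
  have "(F has_derivative (\<lambda>d. G x *v d)) (at x)" using assms by (auto simp: polynomial_field_def)
  from bounded_linear.has_derivative[OF bounded_linear_vec_nth this, of i]
  show ?thesis by (simp add: matrix_vector_mul_component)
qed

lemma polynomial_field_continuous:
  assumes "polynomial_field k F G"
  shows "continuous_on UNIV (\<lambda>x. G x $ i)" "continuous_on UNIV (\<lambda>x. F x $ i)"
proof -
  have "continuous_on UNIV (\<lambda>x. \<chi> j. G x $ i $ j)"
    using assms by (intro continuous_intros poly2_le_continuous) (auto simp: polynomial_field_def)
  then show "continuous_on UNIV (\<lambda>x. G x $ i)" by simp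
  show "continuous_on UNIV (\<lambda>x. F x $ i)" using polynomial_field_component[OF assms]
    by (meson continuous_at_imp_continuous_on has_derivative_continuous)
qed

lemma edge_flux_commute:
  assumes "polynomial_field k F G" shows "edge_flux F b a = - edge_flux F a b"
  using edge_mean_commute[OF polynomial_field_continuous(2)[OF assms]] unfolding edge_flux_def
  by (simp add: algebra_simps)

text \<open>The trace of the Jacobian matrix is determined by the derivatives along two edges of the triangle,
  and the integral of each of these is a difference of edge means.\<close>

lemma divergence_theorem_triangle:
  assumes nz: "cross2 (b - a) (c - a) \<noteq> 0" and F: "polynomial_field k F G"
  shows "integral (convex hull {a, b, c}) (\<lambda>x. trace (G x))
    = sgn (cross2 (b - a) (c - a)) * (edge_flux F a b + edge_flux F b c + edge_flux F c a)"
proof -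
  let ?d = "cross2 (b - a) (c - a)" and ?K = "convex hull {a, b, c}"
  let ?m = "\<lambda>i. edge_mean (\<lambda>x. F x $ i)"
  have nz': "cross2 (a - c) (b - c) \<noteq> 0" "cross2 (c - b) (a - b) \<noteq> 0"
    and d': "cross2 (a - c) (b - c) = ?d" "cross2 (c - b) (a - b) = ?d"
    using nz by (auto simp: cross2_def algebra_simps)
  have perm: "convex hull {c, a, b} = ?K" "convex hull {b, c, a} = ?K" by (simp_all add: insert_commute)
  have 1: "integral ?K (\<lambda>x. G x $ i \<bullet> (b - a)) = \<bar>?d\<bar> * (?m i c b - ?m i c a)" for i
    using integral_directional_derivative[OF nz'(1) polynomial_field_component[OF F, of i] polynomial_field_continuous(1)[OF F, of i]]
    by (simp add: perm d')
  have 2: "integral ?K (\<lambda>x. G x $ i \<bullet> (a - c)) = \<bar>?d\<bar> * (?m i b a - ?m i b c)" for i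
    using integral_directional_derivative[OF nz'(2) polynomial_field_component[OF F, of i] polynomial_field_continuous(1)[OF F, of i]]
    by (simp add: perm d')
  have comm: "?m i c b = ?m i b c" "?m i b a = ?m i a b" for i
    by (rule edge_mean_commute[OF polynomial_field_continuous(2)[OF F]])+
  have int: "(\<lambda>x. G x $ i \<bullet> w) integrable_on ?K" for i w
    by (intro set_lebesgue_integral_eq_integral(1) set_integrable_continuous_compact continuous_intros polynomial_field_continuous(1)[OF F]
      finite_imp_compact_convex_hull) auto
  \<comment> \<open>In the basis \<open>b - a\<close>, \<open>c - a\<close>: \<open>det(e\<^sub>1, e\<^sub>2) tr G = det(G e\<^sub>1, e\<^sub>2) + det(e\<^sub>1, G e\<^sub>2)\<close>.\<close>
  have tr: "?d * trace (G x) = (c - a)$2 * (G x $ 1 \<bullet> (b - a)) - (c - a)$1 * (G x $ 2 \<bullet> (b - a))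
      + (b - a)$2 * (G x $ 1 \<bullet> (a - c)) - (b - a)$1 * (G x $ 2 \<bullet> (a - c))" for x
    by (simp add: trace_def sum_2 inner_vec_def cross2_def algebra_simps)
  have "?d * integral ?K (\<lambda>x. trace (G x)) = integral ?K (\<lambda>x. ?d * trace (G x))" by simp
  also have "\<dots> = (c - a)$2 * integral ?K (\<lambda>x. G x $ 1 \<bullet> (b - a)) - (c - a)$1 * integral ?K (\<lambda>x. G x $ 2 \<bullet> (b - a))
      + (b - a)$2 * integral ?K (\<lambda>x. G x $ 1 \<bullet> (a - c)) - (b - a)$1 * integral ?K (\<lambda>x. G x $ 2 \<bullet> (a - c))"
    unfolding tr using int
    by (subst integral_diff integral_add; (intro integrable_diff integrable_add integrable_on_mult_right)?; simp?)+
  also have "\<dots> = \<bar>?d\<bar> * (edge_flux F a b + edge_flux F b c + edge_flux F c a)"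
    unfolding 1 2 edge_flux_def comm by (simp add: algebra_simps)
  finally have "?d * integral ?K (\<lambda>x. trace (G x)) = ?d * (sgn ?d * (edge_flux F a b + edge_flux F b c + edge_flux F c a))"
    by (simp only: abs_sgn[of ?d] mult.assoc)
  then show ?thesis using nz by simp
qed

section \<open>Cancellation over incidences\<close>

text \<open>With three indices \<open>x\<close>, \<open>y\<close>, \<open>z\<close> the relations give \<open>f x = - f x\<close>, so all terms vanish; with two
  indices the terms cancel.\<close>

lemma sum_cancel_pairs:
  fixes f :: "'a \<Rightarrow> 'b::real_vector"
  assumes "finite A" and pair: "\<And>x y. x \<in> A \<Longrightarrow> y \<in> A \<Longrightarrow> x \<noteq> y \<Longrightarrow> f x = - f y"
    and single: "\<And>x. A = {x} \<Longrightarrow> f x = 0"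
  shows "sum f A = 0"
proof (cases "\<exists>x y z. x \<in> A \<and> y \<in> A \<and> z \<in> A \<and> x \<noteq> y \<and> y \<noteq> z \<and> x \<noteq> z")
  case True
  then obtain x y z where xyz: "x \<in> A" "y \<in> A" "z \<in> A" "x \<noteq> y" "y \<noteq> z" "x \<noteq> z" by blast
  have "f x = - f y" "f y = - f z" "f x = - f z" by (rule pair; use xyz in simp)+
  then have "f x = - f x" by simp
  then have "2 *\<^sub>R f x = 0" by (metis add.right_inverse scaleR_2)
  then have fx: "f x = 0" by simp
  have "f w = 0" if "w \<in> A" for w
    using pair[OF that xyz(1)] fx by (cases "w = x") auto
  then show ?thesis by simp
next
  case no3: False
  show ?thesis
  proof (cases "A = {}")
    case False
    then obtain x where x: "x \<in> A" by blast
    show ?thesis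
    proof (cases "A = {x}")
      case False
      then obtain y where y: "y \<in> A" "y \<noteq> x" using x by blast
      then have "A = {x, y}" using no3 x by blast
      then show ?thesis using pair[OF y(1) x] y by simp
    qed (use single in simp)
  qed simp
qed

text \<open>The cancellation pattern behind both orthogonality statements. Here \<open>S\<close> is a set of triangles and
  \<open>ed K\<close> a set of (descriptions of) edges of \<open>K\<close>; contributions of an edge common to two triangles are
  opposite, and an edge of a single triangle, being on the boundary, contributes nothing.\<close>

lemma sum_cancel_incidence:
  fixes F :: "'a \<Rightarrow> 'e \<Rightarrow> 'b::real_vector"
  assumes fin: "finite S" "\<And>K. K \<in> S \<Longrightarrow> finite (ed K)"
    and pair: "\<And>K K' E. K \<in> S \<Longrightarrow> K' \<in> S \<Longrightarrow> K \<noteq> K' \<Longrightarrow> E \<in> ed K \<Longrightarrow> E \<in> ed K' \<Longrightarrow> F K E = - F K' E"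
    and single: "\<And>K E. K \<in> S \<Longrightarrow> E \<in> ed K \<Longrightarrow> (\<And>K'. K' \<in> S \<Longrightarrow> K' \<noteq> K \<Longrightarrow> E \<notin> ed K') \<Longrightarrow> F K E = 0"
  shows "(\<Sum>K\<in>S. \<Sum>E\<in>ed K. F K E) = 0"
proof -
  let ?U = "\<Union>K\<in>S. ed K"
  have finU: "finite ?U" using fin by auto
  have "(\<Sum>K\<in>S. \<Sum>E\<in>ed K. F K E) = (\<Sum>K\<in>S. \<Sum>E\<in>?U. if E \<in> ed K then F K E else 0)"
  proof (rule sum.cong[OF refl])
    fix K assume "K \<in> S"
    then have "ed K = {E \<in> ?U. E \<in> ed K}" by auto
    then show "(\<Sum>E\<in>ed K. F K E) = (\<Sum>E\<in>?U. if E \<in> ed K then F K E else 0)"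
      using sum.inter_filter[OF finU, of "F K" "\<lambda>E. E \<in> ed K"] by simp
  qed
  also have "\<dots> = (\<Sum>E\<in>?U. \<Sum>K\<in>S. if E \<in> ed K then F K E else 0)" by (rule sum.swap)
  also have "\<dots> = (\<Sum>E\<in>?U. \<Sum>K\<in>{K \<in> S. E \<in> ed K}. F K E)"
    by (intro sum.cong refl sum.inter_filter[symmetric] fin)
  also have "\<dots> = 0"
  proof (rule sum.neutral, rule ballI)
    fix E
    show "(\<Sum>K\<in>{K \<in> S. E \<in> ed K}. F K E) = 0"
    proof (rule sum_cancel_pairs)
      fix K assume "{K \<in> S. E \<in> ed K} = {K}"
      then have "K \<in> S \<and> E \<in> ed K" "\<And>K'. K' \<in> S \<Longrightarrow> K' \<noteq> K \<Longrightarrow> E \<notin> ed K'" by blast+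
      then show "F K E = 0" using single by blast
    next
      fix K K' assume "K \<in> {K \<in> S. E \<in> ed K}" "K' \<in> {K \<in> S. E \<in> ed K}" "K \<noteq> K'"
      then show "F K E = - F K' E" using pair by blast
    qed (use fin in simp)
  qed
  finally show ?thesis .
qed

section \<open>Triangles and face-to-face meshes\<close>

lemma cross2_eq_0_iff: "cross2 u v = 0 \<longleftrightarrow> u = 0 \<or> (\<exists>t. v = t *\<^sub>R u)"
proof
  assume *: "cross2 u v = 0"
  show "u = 0 \<or> (\<exists>t. v = t *\<^sub>R u)"
  proof (cases "u$1 = 0")
    case False
    then have "v = (v$1 / u$1) *\<^sub>R u" using * by (simp add: vec2_eq_iff cross2_def field_simps)
    then show ?thesis by blast
  next
    case True
    show ?thesis
    proof (cases "u$2 = 0")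
      case False
      then have "v = (v$2 / u$2) *\<^sub>R u" using * True by (simp add: vec2_eq_iff cross2_def)
      then show ?thesis by blast
    qed (use True in \<open>simp add: vec2_eq_iff\<close>)
  qed
qed (auto simp: cross2_def)

lemma collinear_iff_cross2: "collinear {a, b, c} \<longleftrightarrow> cross2 (b - a) (c - a) = 0"
proof -
  have "collinear {a, b, c} \<longleftrightarrow> collinear {b, a, c}" by (simp add: insert_commute)
  also have "\<dots> \<longleftrightarrow> collinear {0, b - a, c - a}" by (rule collinear_3) (simp add: NO_MATCH_def)
  also have "\<dots> \<longleftrightarrow> cross2 (b - a) (c - a) = 0"
    unfolding collinear_lemma cross2_eq_0_iff by (metis scaleR_zero_left)
  finally show ?thesis .
qed

lemma triangle_affine_independent:
  assumes "cross2 (b - a) (c - a) \<noteq> 0"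
  shows "\<not> affine_dependent {a, b, c}" "a \<noteq> b" "a \<noteq> c" "b \<noteq> c"
  using assms collinear_iff_cross2[of a b c] by (auto simp: collinear_3_eq_affine_dependent)

lemma extreme_points_triangle:
  assumes "cross2 (b - a) (c - a) \<noteq> 0"
  shows "x extreme_point_of convex hull {a, b, c} \<longleftrightarrow> x \<in> {a, b, c}"
  by (rule extreme_point_of_convex_hull_affine_independent[OF triangle_affine_independent(1)[OF assms]])

lemma cross2_perm:
  "cross2 (c - a) (b - a) = - cross2 (b - a) (c - a)"
  "cross2 (c - b) (a - b) = cross2 (b - a) (c - a)"
  "cross2 (a - c) (b - c) = cross2 (b - a) (c - a)"
  by (simp_all add: cross2_def algebra_simps)

lemma simplex_triangle:
  assumes "2 simplex K"
  obtains a b c where "K = convex hull {a, b, c}" "cross2 (b - a) (c - a) \<noteq> 0"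
proof -
  obtain C where C: "\<not> affine_dependent C" "int (card C) = 3" "K = convex hull C"
    using assms by (auto simp: simplex_def)
  then obtain a b c where abc: "C = {a, b, c}" "a \<noteq> b" "a \<noteq> c" "b \<noteq> c"
    by (metis card_3_iff of_nat_eq_iff of_nat_numeral)
  then have "cross2 (b - a) (c - a) \<noteq> 0"
    using C(1) collinear_iff_cross2[of a b c] collinear_3_eq_affine_dependent[of a b c] by auto
  then show ?thesis using that C(3) abc(1) by blast
qed

lemma triangle_at_vertex:
  assumes "2 simplex K" "a extreme_point_of K"
  obtains b c where "K = convex hull {a, b, c}" "cross2 (b - a) (c - a) \<noteq> 0"
proof -
  obtain u v w where uvw: "K = convex hull {u, v, w}" "cross2 (v - u) (w - u) \<noteq> 0"
    using simplex_triangle[OF assms(1)] .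
  then consider "a = u" | "a = v" | "a = w" using assms(2) extreme_points_triangle[OF uvw(2)] by auto
  then show ?thesis
  proof cases
    case 2
    have "K = convex hull {a, w, u}" unfolding uvw(1) 2 by (rule arg_cong[of _ _ "(hull) convex"]) auto
    moreover have "cross2 (w - a) (u - a) \<noteq> 0" using uvw(2) unfolding 2 by (simp only: cross2_perm(2)[of w v u] not_False_eq_True)
    ultimately show ?thesis by (rule that)
  next
    case 3
    have "K = convex hull {a, u, v}" unfolding uvw(1) 3 by (rule arg_cong[of _ _ "(hull) convex"]) auto
    moreover have "cross2 (u - a) (v - a) \<noteq> 0" using uvw(2) unfolding 3 by (simp only: cross2_perm(3)[of u w v] not_False_eq_True)
    ultimately show ?thesis by (rule that)
  qed (use that uvw in blast)
qed

lemma triangle_at_edge: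
  assumes "2 simplex K" "u extreme_point_of K" "v extreme_point_of K" "u \<noteq> v"
  obtains w where "K = convex hull {u, v, w}" "cross2 (v - u) (w - u) \<noteq> 0"
proof -
  obtain b c where bc: "K = convex hull {u, b, c}" "cross2 (b - u) (c - u) \<noteq> 0"
    using triangle_at_vertex[OF assms(1,2)] .
  then consider "v = b" | "v = c" using assms(3,4) extreme_points_triangle[OF bc(2)] by auto
  then show ?thesis
  proof cases
    case 2
    then show ?thesis using that[of b] bc cross2_perm(1)[of b u c] by (simp add: insert_commute)
  qed (use that bc in blast)
qed

lemma triangle_edge:
  fixes K :: "(real^2) set"
  assumes "2 simplex K" "u extreme_point_of K" "v extreme_point_of K" "u \<noteq> v"
  shows "closed_segment u v edge_of K"
proof -
  obtain w where w: "K = convex hull {u, v, w}" "cross2 (v - u) (w - u) \<noteq> 0"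
    using triangle_at_edge[OF assms] .
  have "closed_segment u v face_of K"
    unfolding w(1) face_of_convex_hull_affine_independent[OF triangle_affine_independent(1)[OF w(2)]]
    by (intro exI[of _ "{u, v}"]) (auto simp: segment_convex_hull)
  moreover have "aff_dim (closed_segment u v) = 1"
    unfolding segment_convex_hull aff_dim_convex_hull using assms(4) by (simp add: aff_dim_2)
  ultimately show ?thesis by (simp add: edge_of_def)
qed

lemma extreme_points_of_edge:
  assumes "closed_segment u v edge_of K"
  shows "u extreme_point_of K" "v extreme_point_of K"
  using assms extreme_point_of_face[of "closed_segment u v" K] by (auto simp: edge_of_def extreme_point_of_segment)

text \<open>The part of the definition of a regular triangulation that is inherited by subsets such as patches.\<close>

definition face_to_face :: "(real^2) set set \<Rightarrow> bool" where
  "face_to_face S \<longleftrightarrow> finite S \<and> (\<forall>K\<in>S. 2 simplex K) \<and>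
     (\<forall>K\<in>S. \<forall>K'\<in>S. K \<noteq> K' \<longrightarrow> K \<inter> K' = {} \<or>
        (K \<inter> K') edge_of K \<and> (K \<inter> K') edge_of K' \<or>
        (\<exists>x. K \<inter> K' = {x} \<and> x extreme_point_of K \<and> x extreme_point_of K'))"

lemma face_to_faceD:
  assumes "face_to_face S"
  shows "finite S" "\<And>K. K \<in> S \<Longrightarrow> 2 simplex K"
    "\<And>K K'. \<lbrakk>K \<in> S; K' \<in> S; K \<noteq> K'\<rbrakk> \<Longrightarrow> K \<inter> K' = {} \<or>
        (K \<inter> K') edge_of K \<and> (K \<inter> K') edge_of K' \<or>
        (\<exists>x. K \<inter> K' = {x} \<and> x extreme_point_of K \<and> x extreme_point_of K')"
  using assms unfolding face_to_face_def by blast+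

lemma face_to_face_subset: "face_to_face S \<Longrightarrow> S' \<subseteq> S \<Longrightarrow> face_to_face S'"
  unfolding face_to_face_def by (meson finite_subset subset_iff)

lemma triangle_compact:
  fixes K :: "(real^2) set"
  assumes "2 simplex K" shows "compact K" "convex K"
  using assms by (auto simp: simplex_def aff_independent_finite finite_imp_compact_convex_hull)

lemma aff_dim_triangle: "2 simplex K \<Longrightarrow> aff_dim K = 2"
  by (simp add: aff_dim_simplex)

text \<open>There are no hanging nodes: the common part of two triangles is a face of both.\<close>

lemma vertex_in_triangle:
  assumes S: "face_to_face S" and "K \<in> S" "K' \<in> S" "x extreme_point_of K'" "x \<in> K"
  shows "x extreme_point_of K"
proof (cases "K = K'")
  case False
  have x: "x \<in> K \<inter> K'" using assms by (auto simp: extreme_point_of_def)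
  consider "(K \<inter> K') face_of K" | y where "K \<inter> K' = {y}" "y extreme_point_of K"
    using face_to_faceD(3)[OF S assms(2,3) False] x unfolding edge_of_def by blast
  then show ?thesis
  proof cases
    case 1
    have "x extreme_point_of (K \<inter> K')"
      using assms(4) x by (auto simp: extreme_point_of_def)
    then show ?thesis using extreme_point_of_face[OF 1] by blast
  qed (use x in simp)
qed (use assms in simp)

lemma shared_edge:
  assumes S: "face_to_face S" and K: "K \<in> S" "K' \<in> S" "K \<noteq> K'"
    and u: "u extreme_point_of K" "u extreme_point_of K'" and v: "v extreme_point_of K" "v extreme_point_of K'"
    and "u \<noteq> v"
  shows "K \<inter> K' = closed_segment u v"
proof -
  note simp2 = face_to_faceD(2)[OF S]
  have E: "closed_segment u v edge_of K" "closed_segment u v edge_of K'"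
    using triangle_edge simp2 K u v \<open>u \<noteq> v\<close> by blast+
  have sub: "closed_segment u v \<subseteq> K \<inter> K'" using E by (auto simp: edge_of_def face_of_def)
  have "(K \<inter> K') edge_of K"
  proof -
    have "u \<in> K \<inter> K'" "v \<in> K \<inter> K'" using sub by auto
    then have "\<nexists>x. K \<inter> K' = {x}" "K \<inter> K' \<noteq> {}" using \<open>u \<noteq> v\<close> by (metis singletonD, blast)
    then show ?thesis using face_to_faceD(3)[OF S K] by blast
  qed
  moreover have "closed_segment u v face_of (K \<inter> K')"
    using E(1) sub by (auto simp: edge_of_def intro: face_of_subset)
  moreover have "convex (K \<inter> K')" using triangle_compact simp2 K by (simp add: convex_Int)
  ultimately show ?thesis using face_of_aff_dim_lt[of "K \<inter> K'" "closed_segment u v"] E(1) by (auto simp: edge_of_def)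
qed

text \<open>A relative interior point \<open>x\<close> of the edge lies in no other triangle, since the common part would be a
  face of \<open>K\<close> that contains \<open>x\<close> and hence the whole edge. Near \<open>x\<close> the union is therefore just \<open>K\<close>, and a
  proper face of \<open>K\<close> misses the interior of \<open>K\<close>.\<close>

lemma free_edge_frontier:
  assumes S: "face_to_face S" and K: "K \<in> S" and u: "u extreme_point_of K" and v: "v extreme_point_of K"
    and "u \<noteq> v" and free: "\<And>K'. K' \<in> S \<Longrightarrow> K' \<noteq> K \<Longrightarrow> \<not> (u extreme_point_of K' \<and> v extreme_point_of K')"
  shows "closed_segment u v \<subseteq> frontier (\<Union>S)"
proof -
  let ?E = "closed_segment u v"
  have E: "?E edge_of K" using triangle_edge face_to_faceD(2)[OF S K] u v \<open>u \<noteq> v\<close> by blast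
  then have ES: "?E \<subseteq> K" by (simp add: edge_of_def face_of_imp_subset)
  have closed: "closed (\<Union>T)" if "T \<subseteq> S" for T
    using that face_to_faceD[OF S] triangle_compact by (meson closed_Union compact_imp_closed finite_subset subsetD)
  have "x \<in> frontier (\<Union>S)" if x: "x \<in> rel_interior ?E" for x
  proof -
    have xE: "x \<in> ?E" using x rel_interior_subset by blast
    have other: "x \<notin> K'" if K': "K' \<in> S" "K' \<noteq> K" for K'
    proof
      assume "x \<in> K'"
      have xK: "x \<in> K \<inter> K'" using \<open>x \<in> K'\<close> xE E by (auto simp: edge_of_def face_of_def)
      consider "(K \<inter> K') edge_of K" "(K \<inter> K') edge_of K'" | "(K \<inter> K') face_of K" "K \<inter> K' = {x}"
        using face_to_faceD(3)[OF S K K'(1)] K'(2) xK by (metis empty_iff face_of_singleton singletonD)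
      then show False
      proof cases
        case 1
        have "?E \<subseteq> K \<inter> K'"
          using 1(1) x xK by (intro subset_of_face_of[OF _ ES]) (auto simp: edge_of_def)
        then have "?E face_of (K \<inter> K')" using E by (auto simp: edge_of_def intro: face_of_subset)
        moreover have "convex (K \<inter> K')" using triangle_compact face_to_faceD(2)[OF S] K K' by (simp add: convex_Int)
        ultimately have "?E = K \<inter> K'" using face_of_aff_dim_lt[of "K \<inter> K'" ?E] 1 E by (auto simp: edge_of_def)
        then have "?E edge_of K'" using 1(2) by simp
        then show False using free[OF K'] extreme_points_of_edge by blast
      next
        case 2
        have "?E \<subseteq> K \<inter> K'" using x xK by (intro subset_of_face_of[OF 2(1) ES]) blast
        then have "?E \<subseteq> {x}" using 2(2) by simp
        then show False using \<open>u \<noteq> v\<close> by auto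
      qed
    qed
    have "x \<notin> interior (\<Union>S)"
    proof
      assume "x \<in> interior (\<Union>S)"
      moreover have "open (- \<Union>(S - {K}))" using closed[of "S - {K}"] by auto
      moreover have "x \<in> - \<Union>(S - {K})" using other by auto
      ultimately have "x \<in> interior (\<Union>S) \<inter> - \<Union>(S - {K})" "open (interior (\<Union>S) \<inter> - \<Union>(S - {K}))" by auto
      moreover have "interior (\<Union>S) \<inter> - \<Union>(S - {K}) \<subseteq> K" using interior_subset by blast
      ultimately have "x \<in> interior K" by (meson interiorI)
      moreover have "?E \<inter> interior K = {}"
      proof (rule face_of_disjoint_interior)
        show "?E face_of K" using E by (simp add: edge_of_def)
        show "?E \<noteq> K" using E aff_dim_triangle[OF face_to_faceD(2)[OF S K]] by (auto simp: edge_of_def)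
      qed
      ultimately show False using xE by blast
    qed
    moreover have "x \<in> \<Union>S" using xE E K by (auto simp: edge_of_def face_of_def)
    ultimately show ?thesis using closure_subset[of "\<Union>S"] by (auto simp: frontier_def)
  qed
  then have "closure (rel_interior ?E) \<subseteq> frontier (\<Union>S)" by (intro closure_minimal) auto
  then show ?thesis by (simp add: convex_closure_rel_interior)
qed

text \<open>If \<open>c\<close> and \<open>d\<close> were on the same side, a short step from the midpoint of the edge towards \<open>c\<close> would stay
  in both triangles and leave the edge.\<close>

lemma shared_edge_opposite_sides:
  fixes u v c d :: "real^2"
  assumes int: "convex hull {u, v, c} \<inter> convex hull {u, v, d} = closed_segment u v"
    and c: "cross2 (v - u) (c - u) \<noteq> 0" and d: "cross2 (v - u) (d - u) \<noteq> 0"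
  shows "sgn (cross2 (v - u) (c - u)) = - sgn (cross2 (v - u) (d - u))"
proof (rule ccontr)
  assume "sgn (cross2 (v - u) (c - u)) \<noteq> - sgn (cross2 (v - u) (d - u))"
  then have same: "cross2 (v - u) (c - u) / cross2 (v - u) (d - u) > 0"
    using c d by (auto simp: sgn_if zero_less_divide_iff split: if_splits)
  define y where "y = cross2 (v - u) (c - u) / cross2 (v - u) (d - u)"
  have "cross2 (v - u) (c - u - y *\<^sub>R (d - u)) = 0"
    using d by (simp add: y_def cross2_def field_simps)
  moreover have "v - u \<noteq> 0" using c by (auto simp: cross2_def)
  ultimately obtain x where x: "c - u - y *\<^sub>R (d - u) = x *\<^sub>R (v - u)"
    unfolding cross2_eq_0_iff by blast
  then have cu: "c = u + (x *\<^sub>R (v - u) + y *\<^sub>R (d - u))" by (simp add: algebra_simps)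
  have aux: "0 \<le> (1 - e) / 2 + X \<and> (1 - e) / 2 + X + Y \<le> 1 \<and> 0 \<le> Y"
    if "- W \<le> X" "X \<le> W" "0 < Y" "e + W + Y = 1 / 2" "0 < e" for e X Y W :: real
    using that by (simp add: field_simps)
  obtain w where w: "0 \<le> w + x" "0 \<le> w - x" "0 \<le> w" by (rule that[of "\<bar>x\<bar>"]) auto
  \<comment> \<open>The step length \<open>e\<close> makes the coordinates \<open>(1 - e)/2 + e x\<close> and \<open>e y\<close> of the new point, relative to
    \<open>v - u\<close> and \<open>d - u\<close>, nonnegative with sum at most one.\<close>
  define e where "e = 1 / (2 * (1 + w + y))"
  have y0: "y > 0" using same by (simp add: y_def)
  have e0: "0 < e" "e < 1" using y0 w by (auto simp: e_def field_simps)
  have "e * (2 * (1 + w + y)) = 1" using y0 w by (simp add: e_def)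
  then have h: "e + e * w + e * y = 1/2" by (simp add: algebra_simps)
  have "0 \<le> e * (w + x)" "0 \<le> e * (w - x)" using e0 w by (intro mult_nonneg_nonneg; simp)+
  then have "- (e * w) \<le> e * x" "e * x \<le> e * w" unfolding distrib_left right_diff_distrib by linarith+
  moreover have "0 < e * y" using e0 y0 by simp
  ultimately have bounds: "0 \<le> (1 - e) / 2 + e * x" "(1 - e) / 2 + e * x + e * y \<le> 1" "0 \<le> e * y"
    using h e0 aux by blast+
  let ?p = "((1 - e) / 2) *\<^sub>R u + ((1 - e) / 2) *\<^sub>R v + e *\<^sub>R c"
  have p: "?p = (1 - ((1 - e) / 2 + e * x) - e * y) *\<^sub>R u + ((1 - e) / 2 + e * x) *\<^sub>R v + (e * y) *\<^sub>R d"
    unfolding cu by (simp add: vec2_eq_iff field_simps)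
  have 1: "?p \<in> convex hull {u, v, c}" unfolding convex_hull_3
    using e0 by (intro CollectI exI[of _ "(1 - e) / 2"] exI[of _ e]) (simp add: field_simps)
  have 2: "?p \<in> convex hull {u, v, d}" unfolding p convex_hull_3 using bounds
    by (intro CollectI exI[of _ "1 - ((1 - e) / 2 + e * x) - e * y"] exI[of _ "(1 - e) / 2 + e * x"] exI[of _ "e * y"]) simp
  have "?p \<in> closed_segment u v" using 1 2 int by blast
  then obtain t where t: "?p = (1 - t) *\<^sub>R u + t *\<^sub>R v" by (auto simp: in_segment)
  have "?p - u = t *\<^sub>R (v - u)" unfolding t by (simp add: algebra_simps)
  then have "cross2 (v - u) (?p - u) = 0" by (simp only:) (simp add: cross2_def)
  moreover have "cross2 (v - u) (?p - u) = e * cross2 (v - u) (c - u)"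
    by (simp add: cross2_def field_simps)
  ultimately show False using c e0 by simp
qed

section \<open>Cancellation of fluxes and of alternating derivatives\<close>

text \<open>The terms with \<open>w = u\<close> and \<open>w = v\<close> are zero, so this is the side of the line from \<open>u\<close> to \<open>v\<close> on which the
  third vertex lies; the sum avoids choosing that vertex.\<close>

definition triangle_orientation :: "(real^2) set \<Rightarrow> real^2 \<Rightarrow> real^2 \<Rightarrow> real" where
  "triangle_orientation K u v = (\<Sum>w | w extreme_point_of K. sgn (cross2 (v - u) (w - u)))"

lemma triangle_orientation_eq:
  assumes K: "K = convex hull {u, v, w}" and nz: "cross2 (v - u) (w - u) \<noteq> 0"
  shows "triangle_orientation K u v = sgn (cross2 (v - u) (w - u))"
proof -
  have "{x. x extreme_point_of K} = {u, v, w}" unfolding K using extreme_points_triangle[OF nz] by blast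
  moreover have "cross2 (v - u) 0 = 0" "cross2 (v - u) (v - u) = 0" by (simp_all add: cross2_def)
  ultimately show ?thesis
    using triangle_affine_independent(2-4)[OF nz] by (simp add: triangle_orientation_def)
qed

text \<open>Reversing an edge changes the sign of the orientation and of the flux. Ordered pairs of vertices thus
  need no orientation convention and count each edge twice.\<close>

lemma divergence_theorem_vertex_pairs:
  assumes K: "2 simplex K" and F: "polynomial_field k F G"
  shows "(\<Sum>(u, v)\<in>{(u, v). u extreme_point_of K \<and> v extreme_point_of K \<and> u \<noteq> v}.
       triangle_orientation K u v * edge_flux F u v) = 2 * integral K (\<lambda>x. trace (G x))"
proof -
  obtain a b c where abc: "K = convex hull {a, b, c}" "cross2 (b - a) (c - a) \<noteq> 0"
    using simplex_triangle[OF K] .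
  note ne = triangle_affine_independent(2-4)[OF abc(2)]
  let ?d = "sgn (cross2 (b - a) (c - a))"
  have pairs: "{(u, v). u extreme_point_of K \<and> v extreme_point_of K \<and> u \<noteq> v}
      = {(a, b), (b, a), (b, c), (c, b), (c, a), (a, c)}"
    unfolding abc(1) extreme_points_triangle[OF abc(2)] using ne by auto
  have hull: "K = convex hull {u, v, w}" if "{u, v, w} = {a, b, c}" for u v w using abc(1) that by simp
  have orient: "triangle_orientation K u v = sgn (cross2 (v - u) (w - u))"
    if "{u, v, w} = {a, b, c}" "cross2 (v - u) (w - u) \<noteq> 0" for u v w
    by (rule triangle_orientation_eq[OF hull[OF that(1)] that(2)])
  have c: "cross2 (a - b) (c - b) = - cross2 (b - a) (c - a)" "cross2 (c - b) (a - b) = cross2 (b - a) (c - a)"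
    "cross2 (b - c) (a - c) = - cross2 (b - a) (c - a)" "cross2 (a - c) (b - c) = cross2 (b - a) (c - a)"
    "cross2 (c - a) (b - a) = - cross2 (b - a) (c - a)"
    by (simp_all add: cross2_def algebra_simps)
  have o: "triangle_orientation K a b = ?d" "triangle_orientation K b a = - ?d"
    "triangle_orientation K b c = ?d" "triangle_orientation K c b = - ?d"
    "triangle_orientation K c a = ?d" "triangle_orientation K a c = - ?d"
    using abc(2) c orient[of a b c] orient[of b a c] orient[of b c a] orient[of c b a] orient[of c a b] orient[of a c b]
    by (auto simp: sgn_minus)
  have I: "integral K (\<lambda>x. trace (G x)) = ?d * (edge_flux F a b + edge_flux F b c + edge_flux F c a)"
    unfolding abc(1) by (rule divergence_theorem_triangle[OF abc(2) F])
  show ?thesis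
    unfolding pairs I
    using ne by (simp add: o edge_flux_commute[OF F, of b a] edge_flux_commute[OF F, of c b]
      edge_flux_commute[OF F, of a c] algebra_simps)
qed

lemma segment_subset_triangle:
  fixes K :: "(real^2) set"
  assumes "2 simplex K" "u extreme_point_of K" "v extreme_point_of K"
  shows "closed_segment u v \<subseteq> K"
  using assms triangle_compact(2)[OF assms(1)] by (meson closed_segment_subset extreme_point_of_def)

lemma edge_flux_cong:
  assumes "\<And>x. x \<in> closed_segment u v \<Longrightarrow> F x = F' x"
  shows "edge_flux F u v = edge_flux F' u v"
proof -
  have "u + t *\<^sub>R (v - u) \<in> closed_segment u v" if "t \<in> {0..1}" for t
    using that by (auto simp: in_segment algebra_simps intro!: exI[of _ t])
  then have "F (u + t *\<^sub>R (v - u)) = F' (u + t *\<^sub>R (v - u))" if "t \<in> {0..1}" for t using assms that by blast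
  then have "edge_mean (\<lambda>x. F x $ i) u v = edge_mean (\<lambda>x. F' x $ i) u v" for i
    unfolding edge_mean_def by (intro integral_cong) simp
  then show ?thesis by (simp add: edge_flux_def)
qed

lemma edge_flux_zero: "(\<And>x. x \<in> closed_segment u v \<Longrightarrow> F x = 0) \<Longrightarrow> edge_flux F u v = 0"
  using edge_flux_cong[of u v F "\<lambda>_. 0"] by (simp add: edge_flux_def edge_mean_def)

lemma finite_extreme_points_triangle: "2 simplex K \<Longrightarrow> finite {x. x extreme_point_of (K :: (real^2) set)}"
  by (erule simplex_triangle) (simp add: extreme_points_triangle)

text \<open>The divergence has integral zero over the patch: fluxes through an edge shared by two triangles cancel,
  as the triangles lie on opposite sides and the traces of the field agree, and \<open>v\<close> vanishes
  on the remaining edges.\<close>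

lemma sum_integral_divergence:
  assumes S: "face_to_face S"
    and F: "\<And>K. K \<in> S \<Longrightarrow> polynomial_field k (F K) (G K)"
    and v: "\<And>K x. K \<in> S \<Longrightarrow> x \<in> K \<Longrightarrow> F K x = v x"
    and bd: "\<And>x. x \<in> frontier (\<Union>S) \<Longrightarrow> v x = 0"
  shows "(\<Sum>K\<in>S. integral K (\<lambda>x. trace (G K x))) = 0"
proof -
  note simp2 = face_to_faceD(2)[OF S]
  let ?ed = "\<lambda>K. {(u, v). u extreme_point_of K \<and> v extreme_point_of K \<and> u \<noteq> v}"
  let ?\<Phi> = "\<lambda>K e. case e of (u, w) \<Rightarrow> triangle_orientation K u w * edge_flux (F K) u w"
  have "(\<Sum>K\<in>S. \<Sum>e\<in>?ed K. ?\<Phi> K e) = 0"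
  proof (rule sum_cancel_incidence)
    show "finite S" by (rule face_to_faceD(1)[OF S])
    fix K assume "K \<in> S"
    then have "finite ({x. x extreme_point_of K} \<times> {x. x extreme_point_of K})"
      using finite_extreme_points_triangle simp2 by blast
    then show "finite (?ed K)" by (rule finite_subset[rotated]) auto
  next
    fix K K' e assume K: "K \<in> S" "K' \<in> S" "K \<noteq> K'" and e: "e \<in> ?ed K" "e \<in> ?ed K'"
    then obtain u w where uw: "e = (u, w)" "u extreme_point_of K" "u extreme_point_of K'"
      "w extreme_point_of K" "w extreme_point_of K'" "u \<noteq> w" by auto
    obtain c where c: "K = convex hull {u, w, c}" "cross2 (w - u) (c - u) \<noteq> 0"
      using triangle_at_edge[OF simp2[OF K(1)] uw(2,4,6)] .
    obtain d where d: "K' = convex hull {u, w, d}" "cross2 (w - u) (d - u) \<noteq> 0"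
      using triangle_at_edge[OF simp2[OF K(2)] uw(3,5,6)] .
    have seg: "K \<inter> K' = closed_segment u w" by (rule shared_edge[OF S K uw(2-6)])
    have "triangle_orientation K u w = - triangle_orientation K' u w"
      unfolding triangle_orientation_eq[OF c] triangle_orientation_eq[OF d]
      using seg c d shared_edge_opposite_sides by blast
    moreover have "edge_flux (F K) u w = edge_flux (F K') u w"
      by (rule edge_flux_cong) (use seg v K in \<open>metis IntD1 IntD2\<close>)
    ultimately show "?\<Phi> K e = - ?\<Phi> K' e" by (simp add: uw(1))
  next
    fix K e assume K: "K \<in> S" and e: "e \<in> ?ed K" and free: "\<And>K'. K' \<in> S \<Longrightarrow> K' \<noteq> K \<Longrightarrow> e \<notin> ?ed K'"
    then obtain u w where uw: "e = (u, w)" "u extreme_point_of K" "w extreme_point_of K" "u \<noteq> w" by auto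
    have fr: "closed_segment u w \<subseteq> frontier (\<Union>S)"
      by (rule free_edge_frontier[OF S K uw(2-4)]) (use free uw in auto)
    have sub: "closed_segment u w \<subseteq> K" using segment_subset_triangle simp2 K uw by blast
    have "F K x = 0" if "x \<in> closed_segment u w" for x
      using v[OF K subsetD[OF sub that]] bd[OF subsetD[OF fr that]] by simp
    then have "edge_flux (F K) u w = 0" by (rule edge_flux_zero)
    then show "?\<Phi> K e = 0" by (simp add: uw(1))
  qed
  then have "(\<Sum>K\<in>S. 2 * integral K (\<lambda>x. trace (G K x))) = 0"
    using divergence_theorem_vertex_pairs[OF simp2 F] by (simp add: case_prod_beta)
  then show ?thesis by (simp add: sum_distrib_left[symmetric])
qed

text \<open>Values on the segment determine the one-sided derivative at its end point \<open>x\<close>.\<close>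

lemma derivative_along_segment:
  fixes F F' :: "real^2 \<Rightarrow> real^2"
  assumes "(F has_derivative A) (at x)" "(F' has_derivative A') (at x)"
    and eq: "\<And>y. y \<in> closed_segment x a \<Longrightarrow> F y = F' y"
  shows "A (a - x) = A' (a - x)"
proof -
  have vd: "((\<lambda>t. H (x + t *\<^sub>R (a - x))) has_vector_derivative B (a - x)) (at 0 within cbox 0 1)"
    if "(H has_derivative B) (at x)" for H B :: "real^2 \<Rightarrow> real^2"
  proof -
    have "((\<lambda>t. x + t *\<^sub>R (a - x)) has_derivative (\<lambda>t. t *\<^sub>R (a - x))) (at 0 within cbox 0 1)"
      by (auto intro!: derivative_eq_intros)
    from has_derivative_compose[OF this, of H B] that
    show ?thesis using linear_scale[OF has_derivative_linear[OF that]] by (simp add: has_vector_derivative_def)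
  qed
  have "x + t *\<^sub>R (a - x) \<in> closed_segment x a" if "t \<in> cbox 0 1" for t
    using that by (auto simp: in_segment algebra_simps intro!: exI[of _ t])
  then have e: "F (x + t *\<^sub>R (a - x)) = F' (x + t *\<^sub>R (a - x))" if "t \<in> cbox 0 1" for t using eq that by blast
  have "((\<lambda>t. F (x + t *\<^sub>R (a - x))) has_vector_derivative A' (a - x)) (at 0 within cbox 0 1)"
    by (rule has_vector_derivative_transform[OF _ _ vd[OF assms(2)]]) (use e in auto)
  from vector_derivative_unique_within_closed_interval[OF _ _ vd[OF assms(1)] this] show ?thesis by simp
qed

text \<open>The derivative at \<open>y\<close> in direction \<open>m\<close> of the piece on \<open>K\<close> depends only on \<open>v\<close> along the edge of \<open>K\<close> at \<open>y\<close>
  that is parallel to \<open>m\<close>. Two triangles sharing that edge have equal derivatives and opposite signs;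
  if the edge is on the boundary, the derivative is zero. The edges are indexed by their end
  point \<open>a\<close> different from \<open>y\<close>.\<close>

lemma alternating_derivative_vanishes:
  assumes S: "face_to_face S"
    and F: "\<And>K. K \<in> S \<Longrightarrow> polynomial_field k (F K) (G K)"
    and v: "\<And>K x. K \<in> S \<Longrightarrow> x \<in> K \<Longrightarrow> F K x = v x"
    and bd: "\<And>x. x \<in> frontier (\<Union>S) \<Longrightarrow> v x = 0"
    and ext: "\<And>K. K \<in> S \<Longrightarrow> y \<in> K \<Longrightarrow> y extreme_point_of K"
    and \<sigma>: "sign_function {K \<in> S. y \<in> K} \<sigma>"
    and m: "m \<noteq> 0" "\<And>K. K \<in> S \<Longrightarrow> y \<in> K \<Longrightarrow> \<exists>!a. a extreme_point_of K \<and> a \<noteq> y \<and> cross2 m (a - y) = 0"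
  shows "(\<Sum>K\<in>{K \<in> S. y \<in> K}. \<sigma> K *\<^sub>R (G K y *v m)) = 0"
proof -
  note simp2 = face_to_faceD(2)[OF S]
  let ?S = "{K \<in> S. y \<in> K}"
  let ?ed = "\<lambda>K. {a. a extreme_point_of K \<and> a \<noteq> y \<and> cross2 m (a - y) = 0}"
  have der: "(F K has_derivative (\<lambda>d. G K y *v d)) (at y)" if "K \<in> S" for K
    using F[OF that] by (simp add: polynomial_field_def)
  have along: "A m = A' m" if eq: "A (a - y) = A' (a - y)" and lin: "linear A" "linear A'"
      and par: "cross2 m (a - y) = 0" and ne: "a \<noteq> y"
    for A A' :: "real^2 \<Rightarrow> real^2" and a
  proof -
    obtain t where t: "a - y = t *\<^sub>R m" using par m(1) cross2_eq_0_iff by blast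
    then have "t \<noteq> 0" using ne by auto
    then show ?thesis using eq linear_scale[OF lin(1), of t m] linear_scale[OF lin(2), of t m] unfolding t by simp
  qed
  have zero: "(\<Sum>K\<in>?S. \<Sum>a\<in>?ed K. \<sigma> K *\<^sub>R (G K y *v m)) = 0"
  proof (rule sum_cancel_incidence)
    show "finite ?S" using face_to_faceD(1)[OF S] by simp
    show "finite (?ed K)" if "K \<in> ?S" for K
      by (rule finite_subset[OF _ finite_extreme_points_triangle[OF simp2]]) (use that in auto)
  next
    fix K K' a assume K: "K \<in> ?S" "K' \<in> ?S" "K \<noteq> K'" and a: "a \<in> ?ed K" "a \<in> ?ed K'"
    have yy: "y extreme_point_of K" "y extreme_point_of K'" using ext K by auto
    have "closed_segment y a edge_of K" "closed_segment y a edge_of K'"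
      using triangle_edge[of K y a] triangle_edge[of K' y a] simp2 K a yy by auto
    then have "\<sigma> K = - \<sigma> K'" using \<sigma> K unfolding sign_function_def by blast
    moreover have seg: "closed_segment y a \<subseteq> K" "closed_segment y a \<subseteq> K'"
      using segment_subset_triangle simp2 K a yy by blast+
    have "G K y *v (a - y) = G K' y *v (a - y)"
    proof (rule derivative_along_segment[OF der der])
      fix x assume "x \<in> closed_segment y a"
      then have "x \<in> K" "x \<in> K'" using seg by blast+
      then show "F K x = F K' x" using v K by simp
    qed (use K in auto)
    then have "G K y *v m = G K' y *v m"
      by (rule along) (use a in auto)
    ultimately show "\<sigma> K *\<^sub>R (G K y *v m) = - (\<sigma> K' *\<^sub>R (G K' y *v m))" by simp
  next
    fix K a assume K: "K \<in> ?S" and a: "a \<in> ?ed K" and free: "\<And>K'. K' \<in> ?S \<Longrightarrow> K' \<noteq> K \<Longrightarrow> a \<notin> ?ed K'"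
    have yK: "y extreme_point_of K" using ext K by auto
    have fr: "closed_segment y a \<subseteq> frontier (\<Union>S)"
    proof (rule free_edge_frontier[OF S _ yK])
      fix K' assume "K' \<in> S" "K' \<noteq> K"
      then show "\<not> (y extreme_point_of K' \<and> a extreme_point_of K')"
        using free[of K'] a by (auto simp: extreme_point_of_def)
    qed (use K a in auto)
    have sub: "closed_segment y a \<subseteq> K" using segment_subset_triangle simp2 K a yK by blast
    have "F K x = 0" if "x \<in> closed_segment y a" for x
      using v[OF _ subsetD[OF sub that]] bd[OF subsetD[OF fr that]] K by simp
    then have "G K y *v (a - y) = 0"
      using derivative_along_segment[OF der has_derivative_const[of 0], of K a] K by simp
    then have "G K y *v m = 0"
      using along[of "\<lambda>d. G K y *v d" a "\<lambda>_. 0"] a by (simp add: linear_zero)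
    then show "\<sigma> K *\<^sub>R (G K y *v m) = 0" by simp
  qed
  have single: "(\<Sum>a\<in>?ed K. \<sigma> K *\<^sub>R (G K y *v m)) = \<sigma> K *\<^sub>R (G K y *v m)" if "K \<in> ?S" for K
  proof -
    have "\<exists>!a. a extreme_point_of K \<and> a \<noteq> y \<and> cross2 m (a - y) = 0" using m(2) that by blast
    then obtain a where "?ed K = {a}" by (elim ex1E) blast
    then show ?thesis by simp
  qed
  have "(\<Sum>K\<in>?S. \<sigma> K *\<^sub>R (G K y *v m)) = (\<Sum>K\<in>?S. \<Sum>a\<in>?ed K. \<sigma> K *\<^sub>R (G K y *v m))"
    by (rule sum.cong[OF refl single[symmetric]])
  with zero show ?thesis by (simp only:)
qed

lemma cross2_parallel_trans:
  assumes "m \<noteq> 0" "cross2 m a = 0" "cross2 m b = 0" shows "cross2 a b = 0"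
proof -
  obtain s t where "a = s *\<^sub>R m" "b = t *\<^sub>R m" using assms cross2_eq_0_iff by blast
  then show ?thesis by (simp add: cross2_def)
qed

text \<open>Since a triangle is nondegenerate, its two edges at \<open>y\<close> have one of the directions \<open>m1\<close>, \<open>m2\<close> each. The
  alternating sum of the Jacobian matrices annihilates both directions, hence is zero, and
  so is its trace.\<close>

lemma alternating_divergence_vanishes:
  assumes S: "face_to_face S"
    and F: "\<And>K. K \<in> S \<Longrightarrow> polynomial_field k (F K) (G K)"
    and v: "\<And>K x. K \<in> S \<Longrightarrow> x \<in> K \<Longrightarrow> F K x = v x"
    and bd: "\<And>x. x \<in> frontier (\<Union>S) \<Longrightarrow> v x = 0"
    and ext: "\<And>K. K \<in> S \<Longrightarrow> y \<in> K \<Longrightarrow> y extreme_point_of K"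
    and \<sigma>: "sign_function {K \<in> S. y \<in> K} \<sigma>"
    and m: "cross2 m1 m2 \<noteq> 0"
      "\<And>K a. K \<in> S \<Longrightarrow> y \<in> K \<Longrightarrow> a extreme_point_of K \<Longrightarrow> a \<noteq> y \<Longrightarrow> cross2 m1 (a - y) = 0 \<or> cross2 m2 (a - y) = 0"
  shows "(\<Sum>K\<in>{K \<in> S. y \<in> K}. \<sigma> K * trace (G K y)) = 0"
proof -
  let ?S = "{K \<in> S. y \<in> K}"
  have m0: "m1 \<noteq> 0" "m2 \<noteq> 0" using m(1) by (auto simp: cross2_def)
  have unique: "\<exists>!a. a extreme_point_of K \<and> a \<noteq> y \<and> cross2 m1 (a - y) = 0"
    "\<exists>!a. a extreme_point_of K \<and> a \<noteq> y \<and> cross2 m2 (a - y) = 0" if K: "K \<in> S" "y \<in> K" for K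
  proof -
    obtain b c where bc: "K = convex hull {y, b, c}" "cross2 (b - y) (c - y) \<noteq> 0"
      using triangle_at_vertex[OF face_to_faceD(2)[OF S K(1)] ext[OF K]] .
    have e: "a extreme_point_of K \<and> a \<noteq> y \<longleftrightarrow> a = b \<or> a = c" for a
      unfolding bc(1) extreme_points_triangle[OF bc(2)] using triangle_affine_independent(2-4)[OF bc(2)] by auto
    have or: "cross2 m1 (b - y) = 0 \<or> cross2 m2 (b - y) = 0" "cross2 m1 (c - y) = 0 \<or> cross2 m2 (c - y) = 0"
      using m(2)[OF K] e by blast+
    have no: "\<not> (cross2 m1 (b - y) = 0 \<and> cross2 m1 (c - y) = 0)" "\<not> (cross2 m2 (b - y) = 0 \<and> cross2 m2 (c - y) = 0)"
      using cross2_parallel_trans m0 bc(2) by blast+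
    show "\<exists>!a. a extreme_point_of K \<and> a \<noteq> y \<and> cross2 m1 (a - y) = 0" using e or no by metis
    show "\<exists>!a. a extreme_point_of K \<and> a \<noteq> y \<and> cross2 m2 (a - y) = 0" using e or no by metis
  qed
  let ?R = "\<lambda>i j. \<Sum>K\<in>?S. \<sigma> K * G K y $ i $ j"
  have row: "?R i 1 * m $ 1 + ?R i 2 * m $ 2 = (\<Sum>K\<in>?S. \<sigma> K *\<^sub>R (G K y *v m)) $ i" for i and m :: "real^2"
    by (simp add: matrix_vector_mult_def sum_2 sum.distrib sum_distrib_right distrib_left mult.assoc)
  have z1: "?R i 1 * m1 $ 1 + ?R i 2 * m1 $ 2 = 0" for i
    unfolding row by (subst alternating_derivative_vanishes[OF S F v bd ext \<sigma> m0(1) unique(1)]) auto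
  have z2: "?R i 1 * m2 $ 1 + ?R i 2 * m2 $ 2 = 0" for i
    unfolding row by (subst alternating_derivative_vanishes[OF S F v bd ext \<sigma> m0(2) unique(2)]) auto
  have solve: "p = 0 \<and> q = 0" if "p * m1$1 + q * m1$2 = 0" "p * m2$1 + q * m2$2 = 0" for p q
  proof -
    have "p * cross2 m1 m2 = (p * m1$1 + q * m1$2) * m2$2 - (p * m2$1 + q * m2$2) * m1$2"
      by (simp add: cross2_def algebra_simps)
    also have "\<dots> = 0" unfolding that by simp
    finally have p: "p = 0" using m(1) by simp
    have "q * cross2 m1 m2 = (p * m2$1 + q * m2$2) * m1$1 - (p * m1$1 + q * m1$2) * m2$1"
      by (simp add: cross2_def algebra_simps)
    also have "\<dots> = 0" unfolding that by simp
    finally show ?thesis using m(1) p by simp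
  qed
  have "(\<Sum>K\<in>?S. \<sigma> K * trace (G K y)) = ?R 1 1 + ?R 2 2"
    by (simp add: trace_def sum_2 sum.distrib distrib_left)
  also have "\<dots> = 0" using solve[OF z1 z2] by simp
  finally show ?thesis .
qed

section \<open>The constraint space of a patch\<close>

lemma interior_disjoint:
  assumes S: "face_to_face S" and K: "K \<in> S" "K' \<in> S" "K \<noteq> K'"
  shows "interior K \<inter> interior K' = {}"
proof -
  have "aff_dim (K \<inter> K') \<noteq> 2" using face_to_faceD(3)[OF S K] by (auto simp: edge_of_def)
  then have "interior (K \<inter> K') = {}" using aff_dim_nonempty_interior[of "K \<inter> K'"] by auto
  then show ?thesis by (simp add: interior_Int)
qed

lemma interior_triangle_nonempty:
  fixes K :: "(real^2) set" assumes "2 simplex K" shows "interior K \<noteq> {}"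
proof -
  have "aff_dim K = int (DIM(real^2))" using aff_dim_triangle[OF assms] by simp
  then have "interior K = rel_interior K" using interior_rel_interior_gen[of K] by presburger
  moreover have "K \<noteq> {}" using aff_dim_triangle[OF assms] by (metis aff_dim_empty zero_neq_neg_one neg_numeral_neq_numeral numeral_One)
  ultimately show ?thesis using rel_interior_eq_empty[OF triangle_compact(2)[OF assms]] by presburger
qed

text \<open>The triangles have disjoint interiors and negligible boundaries, so the values of \<open>f\<close> in the open
  triangles determine the integral.\<close>

lemma piecewise_integral:
  fixes f :: "real^2 \<Rightarrow> real"
  assumes S: "face_to_face S"
    and f: "\<And>K x. K \<in> S \<Longrightarrow> x \<in> interior K \<Longrightarrow> f x = h K x"
    and zero: "\<And>x. x \<notin> (\<Union>K\<in>S. interior K) \<Longrightarrow> f x = 0"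
    and cont: "\<And>K. K \<in> S \<Longrightarrow> continuous_on UNIV (h K)"
  shows "set_integrable lebesgue (\<Union>S) f" "(LINT x:\<Union>S|lebesgue. f x) = (\<Sum>K\<in>S. integral K (h K))"
proof -
  note simp2 = face_to_faceD(2)[OF S]
  have int: "set_integrable lebesgue (interior K) (h K)" if "K \<in> S" for K
    by (rule set_integrable_subset[OF set_integrable_continuous_compact[OF cont[OF that] triangle_compact(1)[OF simp2[OF that]]]])
       (auto simp: interior_subset)
  have eq: "indicator (\<Union>S) x *\<^sub>R f x = (\<Sum>K\<in>S. indicator (interior K) x *\<^sub>R h K x)" for x
  proof (cases "x \<in> (\<Union>K\<in>S. interior K)")
    case True
    then obtain K where K: "K \<in> S" "x \<in> interior K" by blast
    have "(\<Sum>K'\<in>S. indicator (interior K') x *\<^sub>R h K' x) = (\<Sum>K'\<in>S. if K' = K then h K x else 0)"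
      using interior_disjoint[OF S _ K(1)] K by (intro sum.cong) (auto simp: indicator_def)
    also have "\<dots> = h K x" using K face_to_faceD(1)[OF S] by simp
    also have "\<dots> = indicator (\<Union>S) x *\<^sub>R f x" using K f interior_subset[of K] by (auto simp: indicator_def)
    finally show ?thesis by (rule sym)
  next
    case False
    then have "(\<Sum>K\<in>S. indicator (interior K) x *\<^sub>R h K x) = 0" by (intro sum.neutral) auto
    then show ?thesis using zero[OF False] by simp
  qed
  have "integrable lebesgue (\<lambda>x. \<Sum>K\<in>S. indicator (interior K) x *\<^sub>R h K x)"
    using int by (intro Bochner_Integration.integrable_sum) (simp add: set_integrable_def)
  then show "set_integrable lebesgue (\<Union>S) f" unfolding set_integrable_def eq .
  have "(LINT x:\<Union>S|lebesgue. f x) = (\<Sum>K\<in>S. LINT x:interior K|lebesgue. h K x)"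
    unfolding set_lebesgue_integral_def eq
    using int by (intro Bochner_Integration.integral_sum) (simp add: set_integrable_def)
  also have "\<dots> = (\<Sum>K\<in>S. integral K (h K))"
  proof (rule sum.cong[OF refl])
    fix K assume K: "K \<in> S"
    have "K - interior K \<subseteq> frontier K" using closure_subset by (auto simp: frontier_def)
    then have "negligible (K - interior K)"
      using negligible_convex_frontier[OF triangle_compact(2)[OF simp2[OF K]]] negligible_subset by blast
    then have "integral (interior K) (h K) = integral K (h K)"
      by (rule integral_subset_negligible[OF interior_subset])
    then show "(LINT x:interior K|lebesgue. h K x) = integral K (h K)"
      using set_lebesgue_integral_eq_integral(2)[OF int[OF K]] by simp
  qed
  finally show "(LINT x:\<Union>S|lebesgue. f x) = (\<Sum>K\<in>S. integral K (h K))" .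
qed

lemma regular_triangulation_face_to_face: "regular_triangulation \<T> \<Omega> \<Longrightarrow> face_to_face \<T>"
  unfolding regular_triangulation_def face_to_face_def by (elim conjE, intro conjI)

lemma face_to_face_patch: "face_to_face \<T> \<Longrightarrow> face_to_face (patch \<T> z)"
  by (rule face_to_face_subset) (auto simp: patch_def)

lemma vec_cont_pw_poly0_pieces:
  assumes v: "v \<in> vec_cont_pw_poly0 \<T> z k"
  shows "\<exists>F G. \<forall>K\<in>patch \<T> z. polynomial_field k (F K) (G K) \<and> (\<forall>x\<in>K. F K x = v x)"
proof -
  have "\<forall>K\<in>patch \<T> z. \<exists>F G. polynomial_field k F G \<and> (\<forall>x\<in>K. F x = v x)"
  proof
    fix K assume K: "K \<in> patch \<T> z"
    have "\<forall>i. \<exists>f\<in>poly2_le k. \<forall>x\<in>K. v x $ i = f x"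
      using v K by (auto simp: vec_cont_pw_poly0_def cont_pw_poly0_def)
    then obtain f where f: "\<And>i. f i \<in> poly2_le k" "\<And>i x. x \<in> K \<Longrightarrow> v x $ i = f i x"
      unfolding Bex_def choice_iff by blast
    have "\<forall>i. \<exists>g1 g2. g1 \<in> poly2_le (k - 1) \<and> g2 \<in> poly2_le (k - 1) \<and>
        (\<forall>x. (f i has_derivative (\<lambda>d. g1 x * d$1 + g2 x * d$2)) (at x))"
      using poly2_le_derivative[OF f(1)] by blast
    then obtain g1 g2 where g: "\<And>i. g1 i \<in> poly2_le (k - 1)" "\<And>i. g2 i \<in> poly2_le (k - 1)"
      "\<And>i x. (f i has_derivative (\<lambda>d. g1 i x * d$1 + g2 i x * d$2)) (at x)"
      unfolding choice_iff by blast
    let ?F = "\<lambda>x. \<chi> i. f i x" and ?G = "\<lambda>x. \<chi> i. (vector [g1 i x, g2 i x] :: real^2)"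
    have "(?F has_derivative (\<lambda>d. ?G x *v d)) (at x)" for x
    proof -
      have "(?F has_derivative (\<lambda>d. \<chi> i. g1 i x * d$1 + g2 i x * d$2)) (at x)"
        by (subst has_derivative_componentwise_within) (auto simp: Basis_vec_def inner_axis intro: g(3))
      moreover have "(\<chi> i. g1 i x * d$1 + g2 i x * d$2) = ?G x *v d" for d :: "real^2"
        by (simp add: vec_eq_iff matrix_vector_mult_def sum_2)
      ultimately show ?thesis by simp
    qed
    moreover have "(\<lambda>x. ?G x $ i $ j) \<in> poly2_le (k - 1)" for i j
      using g(1,2)[of i] exhaust_2[of j] by auto
    ultimately have "polynomial_field k ?F ?G" by (simp add: polynomial_field_def)
    moreover have "\<forall>x\<in>K. ?F x = v x" using f(2) by (simp add: vec_eq_iff)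
    ultimately show "\<exists>F G. polynomial_field k F G \<and> (\<forall>x\<in>K. F x = v x)" by blast
  qed
  then show ?thesis unfolding bchoice_iff by blast
qed

lemma divergence_eq_trace:
  assumes F: "polynomial_field k F G" and eq: "\<And>x. x \<in> K \<Longrightarrow> F x = v x" and x: "x \<in> interior K"
  shows "divergence v x = trace (G x)"
proof -
  have "(F has_derivative (\<lambda>d. G x *v d)) (at x)" using F by (simp add: polynomial_field_def)
  then have "(v has_derivative (\<lambda>d. G x *v d)) (at x)"
    by (rule has_derivative_transform_within_open[OF _ open_interior x]) (use eq interior_subset in blast)
  then have "frechet_derivative v (at x) = (\<lambda>d. G x *v d)" by (rule frechet_derivative_at[symmetric])
  then show ?thesis
    by (simp add: divergence_def trace_def matrix_vector_mul_component inner_axis)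
qed

lemma trace_poly2_le:
  assumes "polynomial_field k F G" shows "(\<lambda>x. trace (G x)) \<in> poly2_le (k - 1)"
proof -
  have "(\<lambda>x. G x $ i $ i) \<in> poly2_le (k - 1)" for i using assms by (simp add: polynomial_field_def)
  from poly2_le_add[OF this[of 1] this[of 2]] show ?thesis by (simp add: trace_def sum_2)
qed

lemma patch_integral_divergence:
  assumes \<T>: "face_to_face \<T>"
    and F: "\<And>K. K \<in> patch \<T> z \<Longrightarrow> polynomial_field k (F K) (G K)"
    and v: "\<And>K x. K \<in> patch \<T> z \<Longrightarrow> x \<in> K \<Longrightarrow> F K x = v x"
    and q: "\<And>K x. K \<in> patch \<T> z \<Longrightarrow> x \<in> interior K \<Longrightarrow> q x = qK K x"
    and qK: "\<And>K. K \<in> patch \<T> z \<Longrightarrow> continuous_on UNIV (qK K)"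
    and zero: "\<And>x. x \<notin> (\<Union>K\<in>patch \<T> z. interior K) \<Longrightarrow> q x = 0"
  shows "set_integrable lebesgue (patch_region \<T> z) (\<lambda>x. q x * divergence v x)"
    "(LINT x:patch_region \<T> z|lebesgue. q x * divergence v x)
      = (\<Sum>K\<in>patch \<T> z. integral K (\<lambda>x. qK K x * trace (G K x)))"
proof -
  have "q x * divergence v x = qK K x * trace (G K x)" if "K \<in> patch \<T> z" "x \<in> interior K" for K x
    using divergence_eq_trace[OF F[OF that(1)] v[OF that(1)] that(2)] q[OF that] by simp
  moreover have "continuous_on UNIV (\<lambda>x. qK K x * trace (G K x))" if "K \<in> patch \<T> z" for K
    by (intro continuous_intros qK that poly2_le_continuous[OF trace_poly2_le[OF F]])
  ultimately show "set_integrable lebesgue (patch_region \<T> z) (\<lambda>x. q x * divergence v x)"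
    "(LINT x:patch_region \<T> z|lebesgue. q x * divergence v x)
      = (\<Sum>K\<in>patch \<T> z. integral K (\<lambda>x. qK K x * trace (G K x)))"
    unfolding patch_region_def
    using piecewise_integral[OF face_to_face_patch[OF \<T>], of z "\<lambda>x. q x * divergence v x" "\<lambda>K x. qK K x * trace (G K x)"]
      zero by auto
qed

lemma pw_poly_pieces:
  assumes "q \<in> pw_poly \<T> z k"
  shows "\<exists>qK. (\<forall>K\<in>patch \<T> z. qK K \<in> poly2_le k \<and> (\<forall>x\<in>interior K. q x = qK K x))
    \<and> (\<forall>x. x \<notin> (\<Union>K\<in>patch \<T> z. interior K) \<longrightarrow> q x = 0)"
proof -
  have "\<forall>K\<in>patch \<T> z. \<exists>f. f \<in> poly2_le k \<and> (\<forall>x\<in>interior K. q x = f x)"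
    using assms unfolding pw_poly_def by blast
  then obtain qK where "\<forall>K\<in>patch \<T> z. qK K \<in> poly2_le k \<and> (\<forall>x\<in>interior K. q x = qK K x)"
    unfolding bchoice_iff by blast
  moreover have "\<forall>x. x \<notin> (\<Union>K\<in>patch \<T> z. interior K) \<longrightarrow> q x = 0"
    using assms unfolding pw_poly_def by blast
  ultimately show ?thesis by blast
qed

lemma subspace_pw_poly: "fun_vs.subspace (pw_poly \<T> z k)"
proof -
  have "(\<lambda>x. 0) \<in> pw_poly \<T> z k" using poly2_le_const by (auto simp: pw_poly_def)
  moreover have "(\<lambda>x. f x + g x) \<in> pw_poly \<T> z k" if "f \<in> pw_poly \<T> z k" "g \<in> pw_poly \<T> z k" for f g
  proof -
    obtain fK where fK: "\<And>K. K \<in> patch \<T> z \<Longrightarrow> fK K \<in> poly2_le k"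
      "\<And>K x. K \<in> patch \<T> z \<Longrightarrow> x \<in> interior K \<Longrightarrow> f x = fK K x"
      "\<And>x. x \<notin> (\<Union>K\<in>patch \<T> z. interior K) \<Longrightarrow> f x = 0" using pw_poly_pieces[OF \<open>f \<in> _\<close>] by blast
    obtain gK where gK: "\<And>K. K \<in> patch \<T> z \<Longrightarrow> gK K \<in> poly2_le k"
      "\<And>K x. K \<in> patch \<T> z \<Longrightarrow> x \<in> interior K \<Longrightarrow> g x = gK K x"
      "\<And>x. x \<notin> (\<Union>K\<in>patch \<T> z. interior K) \<Longrightarrow> g x = 0" using pw_poly_pieces[OF \<open>g \<in> _\<close>] by blast
    have "\<exists>h\<in>poly2_le k. \<forall>x\<in>interior K. f x + g x = h x" if "K \<in> patch \<T> z" for K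
      using poly2_le_add[OF fK(1) gK(1), OF that that] fK(2)[OF that] gK(2)[OF that] by (intro bexI[of _ "\<lambda>x. fK K x + gK K x"]) auto
    then show ?thesis using fK(3) gK(3) by (simp add: pw_poly_def)
  qed
  moreover have "(\<lambda>x. c * f x) \<in> pw_poly \<T> z k" if "f \<in> pw_poly \<T> z k" for f c
  proof -
    obtain fK where fK: "\<And>K. K \<in> patch \<T> z \<Longrightarrow> fK K \<in> poly2_le k"
      "\<And>K x. K \<in> patch \<T> z \<Longrightarrow> x \<in> interior K \<Longrightarrow> f x = fK K x"
      "\<And>x. x \<notin> (\<Union>K\<in>patch \<T> z. interior K) \<Longrightarrow> f x = 0" using pw_poly_pieces[OF \<open>f \<in> _\<close>] by blast
    have "\<exists>h\<in>poly2_le k. \<forall>x\<in>interior K. c * f x = h x" if "K \<in> patch \<T> z" for K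
      using poly2_le_cmult[OF fK(1), OF that] fK(2)[OF that] by (intro bexI[of _ "\<lambda>x. c * fK K x"]) auto
    then show ?thesis using fK(3) by (simp add: pw_poly_def)
  qed
  ultimately show ?thesis
    unfolding fun_vs.subspace_def by (simp add: zero_fun_def plus_fun_def)
qed

text \<open>Additivity of the constraint requires that the products with divergences are integrable, which
  holds because they are piecewise polynomial.\<close>

lemma subspace_N_space:
  assumes \<T>: "face_to_face \<T>"
  shows "fun_vs.subspace (N_space \<T> z p)"
proof -
  have int: "set_integrable lebesgue (patch_region \<T> z) (\<lambda>x. q x * divergence v x)"
    if q: "q \<in> pw_poly \<T> z (p - 1)" and v: "v \<in> vec_cont_pw_poly0 \<T> z p" for q v
  proof -
    obtain F G where FG: "\<And>K. K \<in> patch \<T> z \<Longrightarrow> polynomial_field p (F K) (G K)"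
      "\<And>K x. K \<in> patch \<T> z \<Longrightarrow> x \<in> K \<Longrightarrow> F K x = v x" using vec_cont_pw_poly0_pieces[OF v] by blast
    obtain qK where qK: "\<And>K. K \<in> patch \<T> z \<Longrightarrow> qK K \<in> poly2_le (p - 1)"
      "\<And>K x. K \<in> patch \<T> z \<Longrightarrow> x \<in> interior K \<Longrightarrow> q x = qK K x"
      "\<And>x. x \<notin> (\<Union>K\<in>patch \<T> z. interior K) \<Longrightarrow> q x = 0" using pw_poly_pieces[OF q] by blast
    show ?thesis by (rule patch_integral_divergence(1)[OF \<T> FG qK(2) poly2_le_continuous[OF qK(1)] qK(3)])
  qed
  have sub: "fun_vs.subspace (pw_poly \<T> z (p - 1))" by (rule subspace_pw_poly)
  have "0 \<in> N_space \<T> z p"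
    using fun_vs.subspace_0[OF sub] by (simp add: N_space_def set_lebesgue_integral_def)
  moreover have "f + g \<in> N_space \<T> z p" if f: "f \<in> N_space \<T> z p" and g: "g \<in> N_space \<T> z p" for f g
  proof -
    have pw: "f \<in> pw_poly \<T> z (p - 1)" "g \<in> pw_poly \<T> z (p - 1)" using f g by (simp_all add: N_space_def)
    have "(LINT x:patch_region \<T> z|lebesgue. (f + g) x * divergence v x) = 0"
      if v: "v \<in> vec_cont_pw_poly0 \<T> z p" for v
    proof -
      have "(LINT x:patch_region \<T> z|lebesgue. f x * divergence v x) = 0"
        "(LINT x:patch_region \<T> z|lebesgue. g x * divergence v x) = 0"
        using f g v by (simp_all add: N_space_def)
      then show ?thesis
        using set_integral_add(2)[OF int[OF pw(1) v] int[OF pw(2) v]] by (simp add: distrib_right)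
    qed
    then show ?thesis using fun_vs.subspace_add[OF sub pw] by (simp add: N_space_def)
  qed
  moreover have "(\<lambda>x. c * f x) \<in> N_space \<T> z p" if "f \<in> N_space \<T> z p" for f c
    using that fun_vs.subspace_scale[OF sub, of f c] by (auto simp: N_space_def mult.assoc)
  ultimately show ?thesis unfolding fun_vs.subspace_def by blast
qed

text \<open>By convention the dimension is zero if there is no basis at all, and an infinite basis also has
  cardinality zero. A positive dimension therefore yields a finite basis, to which the exchange
  lemma applies.\<close>

lemma span_eq_of_card_dim:
  assumes sub: "fun_vs.subspace N" and ind: "fun_vs.independent B" and "B \<subseteq> N"
    and dim: "fun_vs.dim N = card B" "card B > 0"
  shows "fun_vs.span B = N"
proof
  show "fun_vs.span B \<subseteq> N" using \<open>B \<subseteq> N\<close> sub by (rule fun_vs.span_minimal)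
  have "\<exists>A. fun_vs.independent A \<and> fun_vs.span A = fun_vs.span N"
  proof (rule ccontr)
    assume "\<not> ?thesis"
    then have "fun_vs.dim N = 0" unfolding fun_vs.dim_def by (rule if_not_P)
    then show False using dim by simp
  qed
  then obtain A where A: "fun_vs.independent A" "fun_vs.span A = fun_vs.span N" by blast
  then have cA: "card A = card B" using fun_vs.dim_eq_card[OF A(2,1)] dim(1) by simp
  then have finA: "finite A" using dim(2) card.infinite by force
  show "N \<subseteq> fun_vs.span B"
  proof (rule ccontr)
    assume "\<not> N \<subseteq> fun_vs.span B"
    then obtain y where y: "y \<in> N" "y \<notin> fun_vs.span B" by blast
    have ind': "fun_vs.independent (insert y B)" using ind y(2) by (simp add: fun_vs.independent_insertI)
    have "insert y B \<subseteq> fun_vs.span A" using y(1) \<open>B \<subseteq> N\<close> A(2) fun_vs.span_superset by auto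
    from fun_vs.independent_span_bound[OF finA ind' this]
    have "card (insert y B) \<le> card A" "finite (insert y B)" by (rule conjunct2, rule conjunct1)
    moreover have "y \<notin> B" using y(2) fun_vs.span_base by blast
    ultimately show False using cA by simp
  qed
qed

lemma one_patch_interior:
  assumes "K \<in> patch \<T> z" "x \<in> interior K" shows "one_patch \<T> z x = 1"
proof -
  have "x \<in> (\<Union>K\<in>patch \<T> z. interior K)" using assms by blast
  then show ?thesis unfolding one_patch_def by (rule indicator_simps)
qed

lemma one_patch_in_N_space:
  assumes \<T>: "face_to_face \<T>"
  shows "one_patch \<T> z \<in> N_space \<T> z p"
proof -
  have zero: "one_patch \<T> z x = 0" if "x \<notin> (\<Union>K\<in>patch \<T> z. interior K)" for x
    using that by (simp add: one_patch_def)
  have "one_patch \<T> z \<in> pw_poly \<T> z (p - 1)"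
    unfolding pw_poly_def
  proof (intro CollectI conjI ballI allI impI)
    fix K assume "K \<in> patch \<T> z"
    then show "\<exists>f\<in>poly2_le (p - 1). \<forall>x\<in>interior K. one_patch \<T> z x = f x"
      using one_patch_interior by (intro bexI[of _ "\<lambda>_. 1"] poly2_le_const) blast
  qed (rule zero)
  moreover have "(LINT x:patch_region \<T> z|lebesgue. one_patch \<T> z x * divergence v x) = 0"
    if v: "v \<in> vec_cont_pw_poly0 \<T> z p" for v
  proof -
    obtain F G where FG: "\<And>K. K \<in> patch \<T> z \<Longrightarrow> polynomial_field p (F K) (G K)"
      "\<And>K x. K \<in> patch \<T> z \<Longrightarrow> x \<in> K \<Longrightarrow> F K x = v x" using vec_cont_pw_poly0_pieces[OF v] by blast
    have bd: "v x = 0" if "x \<in> frontier (\<Union>(patch \<T> z))" for x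
      using v that by (simp add: vec_cont_pw_poly0_def cont_pw_poly0_def patch_region_def vec_eq_iff)
    have "(LINT x:patch_region \<T> z|lebesgue. one_patch \<T> z x * divergence v x)
      = (\<Sum>K\<in>patch \<T> z. integral K (\<lambda>x. 1 * trace (G K x)))"
      by (rule patch_integral_divergence(2)[OF \<T> FG one_patch_interior continuous_on_const zero])
    also have "\<dots> = 0"
      using sum_integral_divergence[OF face_to_face_patch[OF \<T>] FG bd] by simp
    finally show ?thesis .
  qed
  ultimately show ?thesis by (simp add: N_space_def)
qed

section \<open>Barycentric coordinates and critical functions\<close>

lemma cross2_affine: "\<exists>w e. \<forall>x. cross2 (b - x) (c - x) / d = w \<bullet> x + e"
proof (intro exI allI)
  fix x :: "real^2"
  show "cross2 (b - x) (c - x) / d = (vector [(b$2 - c$2) / d, (c$1 - b$1) / d] :: real^2) \<bullet> x + cross2 b c / d"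
    by (simp add: inner_vec_def sum_2 cross2_def add_divide_distrib diff_divide_distrib algebra_simps)
qed

lemma affine_eq_on_triangle:
  assumes nz: "cross2 (b - a) (c - a) \<noteq> 0" and f: "\<forall>x. f x = w \<bullet> x + e" and g: "\<forall>x. g x = w' \<bullet> x + e'"
    and eq: "f a = g a" "f b = g b" "f c = g c"
  shows "f = (g :: real^2 \<Rightarrow> real)"
proof -
  let ?u = "w - w'"
  have 1: "?u \<bullet> (b - a) = 0" "?u \<bullet> (c - a) = 0"
    using eq f g by (simp_all add: inner_diff_left inner_diff_right)
  have "?u$1 * cross2 (b - a) (c - a) = (?u \<bullet> (b - a)) * (c - a)$2 - (?u \<bullet> (c - a)) * (b - a)$2"
    "?u$2 * cross2 (b - a) (c - a) = (?u \<bullet> (c - a)) * (b - a)$1 - (?u \<bullet> (b - a)) * (c - a)$1"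
    by (simp_all add: inner_vec_def sum_2 cross2_def algebra_simps)
  then have "?u$1 = 0" "?u$2 = 0" using nz unfolding 1 by simp_all
  then have "w = w'" by (simp add: vec2_eq_iff)
  then have "e = e'" using eq(1) f g by simp
  then show ?thesis using f g \<open>w = w'\<close> by (simp add: fun_eq_iff)
qed

lemma barycentric_triangle:
  assumes nz: "cross2 (b - a) (c - a) \<noteq> 0"
  shows "barycentric (convex hull {a, b, c}) a = (\<lambda>x. cross2 (b - x) (c - x) / cross2 (b - a) (c - a))"
  unfolding barycentric_def extreme_points_triangle[OF nz]
proof (rule the_equality)
  let ?l = "\<lambda>x. cross2 (b - x) (c - x) / cross2 (b - a) (c - a)"
  have l: "?l a = 1" "?l b = 0" "?l c = 0" using nz by (simp_all add: cross2_def)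
  then show "(\<exists>w e. \<forall>x. ?l x = w \<bullet> x + e) \<and> ?l a = 1 \<and> (\<forall>y. y \<in> {a, b, c} \<and> y \<noteq> a \<longrightarrow> ?l y = 0)"
    using cross2_affine by blast
  fix f assume f: "(\<exists>w e. \<forall>x. f x = w \<bullet> x + e) \<and> f a = 1 \<and> (\<forall>y. y \<in> {a, b, c} \<and> y \<noteq> a \<longrightarrow> f y = 0)"
  have "a \<noteq> b" "a \<noteq> c" using triangle_affine_independent[OF nz] by auto
  then have fv: "f a = ?l a" "f b = ?l b" "f c = ?l c" using f l by auto
  obtain w e where we: "\<forall>x. f x = w \<bullet> x + e" using f by blast
  obtain w' e' where we': "\<forall>x. ?l x = w' \<bullet> x + e'" using cross2_affine by blast
  show "f = ?l" by (rule affine_eq_on_triangle[OF nz we we' fv])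
qed

lemma barycentric_properties:
  assumes K: "2 simplex K" and y: "y extreme_point_of K"
  shows "\<exists>w e. \<forall>x. barycentric K y x = w \<bullet> x + e" "barycentric K y y = 1"
    "\<And>u. u extreme_point_of K \<Longrightarrow> u \<noteq> y \<Longrightarrow> barycentric K y u = 0"
proof -
  obtain b c where bc: "K = convex hull {y, b, c}" "cross2 (b - y) (c - y) \<noteq> 0"
    using triangle_at_vertex[OF K y] .
  note l = barycentric_triangle[OF bc(2)]
  show "\<exists>w e. \<forall>x. barycentric K y x = w \<bullet> x + e" unfolding bc(1) l by (rule cross2_affine)
  show "barycentric K y y = 1" unfolding bc(1) l using bc(2) by simp
  fix u assume "u extreme_point_of K" "u \<noteq> y"
  then have "u = b \<or> u = c" unfolding bc(1) extreme_points_triangle[OF bc(2)] by auto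
  then show "barycentric K y u = 0" unfolding bc(1) l by (auto simp: cross2_def)
qed

lemma barycentric_on_edge:
  assumes K: "2 simplex K" and y: "y extreme_point_of K"
  shows "barycentric K y (u + t *\<^sub>R (v - u)) = (1 - t) * barycentric K y u + t * barycentric K y v"
proof -
  obtain w e where "\<forall>x. barycentric K y x = w \<bullet> x + e" using barycentric_properties(1)[OF assms] by blast
  then show ?thesis by (simp add: inner_diff_right inner_add_right algebra_simps)
qed

definition jacobi_shape :: "nat \<Rightarrow> (real^2) set \<Rightarrow> real^2 \<Rightarrow> real^2 \<Rightarrow> real" where
  "jacobi_shape n K y x = poly (jacobi_poly n 0 2) (1 - 2 * barycentric K y x)"

lemma jacobi_shape_poly2_le:
  assumes "2 simplex K" "y extreme_point_of K" "n \<ge> 1"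
  shows "jacobi_shape n K y \<in> poly2_le n"
proof -
  obtain w e where "\<forall>x. barycentric K y x = w \<bullet> x + e" using barycentric_properties(1)[OF assms(1,2)] by blast
  then have "jacobi_shape n K y = (\<lambda>x. poly (jacobi_poly n 0 2) ((- 2 *\<^sub>R w) \<bullet> x + (1 - 2 * e)))"
    by (simp add: jacobi_shape_def fun_eq_iff algebra_simps)
  also have "\<dots> \<in> poly2_le n" using degree_jacobi[OF assms(3)] by (intro poly2_le_compose_affine) simp
  finally show ?thesis .
qed

lemma integral_jacobi_shape:
  assumes K: "2 simplex K" and y: "y extreme_point_of K" and n: "n \<ge> 1" and h: "h \<in> poly2_le n"
  shows "integral K (\<lambda>x. jacobi_shape n K y x * h x) = measure lebesgue K * jacobi_mean n * h y"
proof -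
  obtain b c where bc: "K = convex hull {y, b, c}" "cross2 (b - y) (c - y) \<noteq> 0"
    using triangle_at_vertex[OF K y] .
  show ?thesis unfolding jacobi_shape_def bc(1) barycentric_triangle[OF bc(2)]
    by (rule jacobi_point_evaluation[OF bc(2) n h])
qed

lemma measure_triangle_pos: "2 simplex K \<Longrightarrow> measure lebesgue (K :: (real^2) set) > 0"
  by (erule simplex_triangle) (simp add: measure_triangle)

lemma critical_fun_interior:
  assumes S: "face_to_face (patch \<T> z)" and K: "K \<in> patch \<T> z" "x \<in> interior K"
  shows "critical_fun \<T> z \<sigma> n y x =
    (if y \<in> K then \<sigma> K / measure lebesgue K * jacobi_shape n K y x else 0)"
proof -
  let ?f = "\<lambda>K. \<sigma> K / measure lebesgue K * jacobi_shape n K y x"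
  have "critical_fun \<T> z \<sigma> n y x = (\<Sum>K'\<in>{K \<in> patch \<T> z. y \<in> K}. if K' = K then ?f K else 0)"
    unfolding critical_fun_def jacobi_shape_def
    using interior_disjoint[OF S _ K(1)] K by (intro sum.cong) (auto simp: indicator_def)
  also have "\<dots> = (if y \<in> K then ?f K else 0)" using K(1) face_to_faceD(1)[OF S] by simp
  finally show ?thesis .
qed

lemma critical_fun_outside:
  assumes "x \<notin> (\<Union>K\<in>patch \<T> z. interior K)" shows "critical_fun \<T> z \<sigma> n y x = 0"
  unfolding critical_fun_def using assms by (intro sum.neutral) auto

lemma critical_point_vertex:
  assumes \<T>: "face_to_face \<T>" and y: "y \<in> critical_points \<T> z" and K: "K \<in> patch \<T> z" "y \<in> K"
  shows "y extreme_point_of K"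
proof -
  obtain K' where "K' \<in> \<T>" "y extreme_point_of K'"
    using y by (auto simp: critical_points_def patch_vertices_def vertices_def)
  then show ?thesis using vertex_in_triangle[OF \<T>] K by (auto simp: patch_def)
qed

text \<open>Two of the three points \<open>y\<close>, \<open>a\<close> and their midpoint lie in the same affine set, which then contains
  all three.\<close>

lemma segment_in_two_lines:
  fixes y a :: "real^2"
  assumes "affine L1" "affine L2" "closed_segment y a \<subseteq> L1 \<union> L2" "y \<noteq> a"
  shows "y \<in> L1 \<and> a \<in> L1 \<or> y \<in> L2 \<and> a \<in> L2"
proof -
  let ?m = "midpoint y a"
  have m: "?m = (1/2) *\<^sub>R y + (1/2) *\<^sub>R a" by (simp add: midpoint_def scaleR_add_right)
  have y: "y \<in> L" if "affine L" "a \<in> L" "?m \<in> L" for L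
  proof -
    have "2 *\<^sub>R ?m + (- 1) *\<^sub>R a \<in> L" using that by (intro mem_affine) auto
    then show ?thesis by (simp add: m scaleR_add_right)
  qed
  have a: "a \<in> L" if "affine L" "y \<in> L" "?m \<in> L" for L
  proof -
    have "2 *\<^sub>R ?m + (- 1) *\<^sub>R y \<in> L" using that by (intro mem_affine) auto
    then show ?thesis by (simp add: m scaleR_add_right)
  qed
  have "y \<in> L1 \<union> L2" "a \<in> L1 \<union> L2" using assms(3) by auto
  moreover have "?m \<in> L1 \<union> L2" using assms(3) midpoint_in_closed_segment by blast
  ultimately have "y \<in> L1 \<union> L2" "a \<in> L1 \<union> L2" "?m \<in> L1 \<union> L2" .
  then show ?thesis using a y assms(1,2) by blast
qed

lemma straight_line_cross2:
  assumes "straight_line L" "x \<in> L" "y \<in> L" "w \<in> L"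
  shows "cross2 (y - x) (w - x) = 0"
proof -
  have "aff_dim {x, y, w} \<le> aff_dim L" using assms by (intro aff_dim_subset) auto
  then show ?thesis using assms(1) by (simp add: straight_line_def collinear_aff_dim[symmetric] collinear_iff_cross2)
qed

text \<open>Both directions are read off a single triangle at \<open>y\<close>: each of its edges at \<open>y\<close> lies in one of the two
  lines, and not both in the same one, as the triangle is nondegenerate.\<close>

lemma critical_point_directions:
  assumes \<T>: "face_to_face \<T>" and y: "y \<in> critical_points \<T> z"
  obtains m1 m2 where "cross2 m1 m2 \<noteq> 0"
    "\<And>K a. K \<in> patch \<T> z \<Longrightarrow> y \<in> K \<Longrightarrow> a extreme_point_of K \<Longrightarrow> a \<noteq> y \<Longrightarrow>
       cross2 m1 (a - y) = 0 \<or> cross2 m2 (a - y) = 0"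
proof -
  obtain L1 L2 where L: "straight_line L1" "straight_line L2"
    "\<And>E. E \<in> patch_edges \<T> z \<Longrightarrow> y extreme_point_of E \<Longrightarrow> E \<subseteq> L1 \<union> L2"
    using y by (auto simp: critical_points_def)
  have simp2: "2 simplex K" if "K \<in> patch \<T> z" for K
    using face_to_faceD(2)[OF face_to_face_patch[OF \<T>] that] .
  have on_line: "y \<in> L1 \<and> a \<in> L1 \<or> y \<in> L2 \<and> a \<in> L2"
    if K: "K \<in> patch \<T> z" "y \<in> K" and a: "a extreme_point_of K" "a \<noteq> y" for K a
  proof -
    have "closed_segment y a edge_of K"
      using triangle_edge[OF simp2[OF K(1)] critical_point_vertex[OF \<T> y K] a(1)] a(2) by blast
    then have "closed_segment y a \<in> patch_edges \<T> z"
      using K(1) face_of_imp_subset by (fastforce simp: patch_edges_def edges_def patch_region_def patch_def edge_of_def)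
    then have "closed_segment y a \<subseteq> L1 \<union> L2" by (rule L(3)) (simp add: extreme_point_of_segment)
    then show ?thesis using segment_in_two_lines L(1,2) a(2) by (metis straight_line_def)
  qed
  obtain K0 where K0: "K0 \<in> patch \<T> z" "y \<in> K0"
    using y by (auto simp: critical_points_def patch_vertices_def patch_region_def)
  obtain b c where bc: "K0 = convex hull {y, b, c}" "cross2 (b - y) (c - y) \<noteq> 0"
    using triangle_at_vertex[OF simp2[OF K0(1)] critical_point_vertex[OF \<T> y K0]] .
  have ext: "b extreme_point_of K0" "b \<noteq> y" "c extreme_point_of K0" "c \<noteq> y"
    using extreme_points_triangle[OF bc(2)] triangle_affine_independent[OF bc(2)] by (auto simp: bc(1))
  have "cross2 (b - y) (a - y) = 0 \<or> cross2 (c - y) (a - y) = 0"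
    if K: "K \<in> patch \<T> z" "y \<in> K" and a: "a extreme_point_of K" "a \<noteq> y" for K a
    using on_line[OF K a] on_line[OF K0 ext(1,2)] on_line[OF K0 ext(3,4)] bc(2)
      straight_line_cross2[OF L(1)] straight_line_cross2[OF L(2)] by blast
  then show ?thesis using that bc(2) by blast
qed

text \<open>By the point evaluation property, the integral of the critical function times the divergence
  is a multiple of the alternating sum of the divergences of the pieces at the critical point.\<close>

lemma critical_fun_in_N_space:
  assumes \<T>: "face_to_face \<T>" and \<sigma>: "admissible_signs \<T> z \<sigma>" and p: "p \<ge> 2"
    and y: "y \<in> critical_points \<T> z"
  shows "critical_fun \<T> z \<sigma> (p - 1) y \<in> N_space \<T> z p"
proof -
  note S = face_to_face_patch[OF \<T>, of z]
  let ?q = "critical_fun \<T> z \<sigma> (p - 1) y"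
  let ?qK = "\<lambda>K x. if y \<in> K then \<sigma> K / measure lebesgue K * jacobi_shape (p - 1) K y x else 0"
  have p1: "p - 1 \<ge> 1" using p by simp
  have ext: "y extreme_point_of K" if "K \<in> patch \<T> z" "y \<in> K" for K
    by (rule critical_point_vertex[OF \<T> y that])
  have shape: "jacobi_shape (p - 1) K y \<in> poly2_le (p - 1)" if "K \<in> patch \<T> z" "y \<in> K" for K
    by (rule jacobi_shape_poly2_le[OF face_to_faceD(2)[OF S that(1)] ext[OF that] p1])
  have qK: "?qK K \<in> poly2_le (p - 1)" if K: "K \<in> patch \<T> z" for K
  proof (cases "y \<in> K")
    case True
    show ?thesis using poly2_le_cmult[OF shape[OF K True]] True by (simp only: if_True)
  qed (simp add: poly2_le_const)
  have pw: "?q \<in> pw_poly \<T> z (p - 1)"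
    unfolding pw_poly_def
  proof (intro CollectI conjI ballI allI impI)
    fix K assume K: "K \<in> patch \<T> z"
    show "\<exists>f\<in>poly2_le (p - 1). \<forall>x\<in>interior K. ?q x = f x"
      by (intro bexI[OF _ qK[OF K]] ballI critical_fun_interior[OF S K])
  qed (rule critical_fun_outside)
  have "(LINT x:patch_region \<T> z|lebesgue. ?q x * divergence v x) = 0"
    if v: "v \<in> vec_cont_pw_poly0 \<T> z p" for v
  proof -
    obtain F G where FG: "\<And>K. K \<in> patch \<T> z \<Longrightarrow> polynomial_field p (F K) (G K)"
      "\<And>K x. K \<in> patch \<T> z \<Longrightarrow> x \<in> K \<Longrightarrow> F K x = v x" using vec_cont_pw_poly0_pieces[OF v] by blast
    have bd: "v x = 0" if "x \<in> frontier (\<Union>(patch \<T> z))" for x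
      using v that by (simp add: vec_cont_pw_poly0_def cont_pw_poly0_def patch_region_def vec_eq_iff)
    obtain m1 m2 where m: "cross2 m1 m2 \<noteq> 0"
      "\<And>K a. K \<in> patch \<T> z \<Longrightarrow> y \<in> K \<Longrightarrow> a extreme_point_of K \<Longrightarrow> a \<noteq> y \<Longrightarrow>
         cross2 m1 (a - y) = 0 \<or> cross2 m2 (a - y) = 0"
      using critical_point_directions[OF \<T> y] by blast
    have \<sigma>y: "sign_function {K \<in> patch \<T> z. y \<in> K} \<sigma>" using \<sigma> y by (simp add: admissible_signs_def)
    have piece: "integral K (\<lambda>x. ?qK K x * trace (G K x)) = (if y \<in> K then jacobi_mean (p - 1) * (\<sigma> K * trace (G K y)) else 0)"
      if K: "K \<in> patch \<T> z" for K
    proof (cases "y \<in> K")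
      case True
      note simp2 = face_to_faceD(2)[OF S K]
      have "integral K (\<lambda>x. ?qK K x * trace (G K x))
        = integral K (\<lambda>x. \<sigma> K / measure lebesgue K * (jacobi_shape (p - 1) K y x * trace (G K x)))"
        using True by (simp add: mult.assoc)
      also have "\<dots> = \<sigma> K / measure lebesgue K * integral K (\<lambda>x. jacobi_shape (p - 1) K y x * trace (G K x))"
        by (rule integral_mult_right)
      also have "\<dots> = \<sigma> K / measure lebesgue K * (measure lebesgue K * jacobi_mean (p - 1) * trace (G K y))"
        by (simp only: integral_jacobi_shape[OF simp2 ext[OF K True] p1 trace_poly2_le[OF FG(1)[OF K]]])
      also have "\<dots> = jacobi_mean (p - 1) * (\<sigma> K * trace (G K y))"
        using measure_triangle_pos[OF simp2] by (simp add: field_simps)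
      finally show ?thesis using True by simp
    qed simp
    have "(LINT x:patch_region \<T> z|lebesgue. ?q x * divergence v x)
      = (\<Sum>K\<in>patch \<T> z. integral K (\<lambda>x. ?qK K x * trace (G K x)))"
      by (rule patch_integral_divergence(2)[OF \<T> FG critical_fun_interior[OF S] poly2_le_continuous[OF qK] critical_fun_outside])
    also have "\<dots> = (\<Sum>K\<in>patch \<T> z. if y \<in> K then jacobi_mean (p - 1) * (\<sigma> K * trace (G K y)) else 0)"
      by (rule sum.cong[OF refl piece])
    also have "\<dots> = (\<Sum>K\<in>{K \<in> patch \<T> z. y \<in> K}. jacobi_mean (p - 1) * (\<sigma> K * trace (G K y)))"
      by (rule sum.inter_filter[symmetric, OF face_to_faceD(1)[OF S]])
    also have "\<dots> = jacobi_mean (p - 1) * (\<Sum>K\<in>{K \<in> patch \<T> z. y \<in> K}. \<sigma> K * trace (G K y))"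
      by (rule sum_distrib_left[symmetric])
    also have "\<dots> = 0"
      using alternating_divergence_vanishes[OF S FG bd ext \<sigma>y m] by simp
    finally show ?thesis .
  qed
  with pw show ?thesis by (simp add: N_space_def)
qed

section \<open>Linear independence\<close>

text \<open>For even degree \<open>n\<close> the polynomials \<open>P(2 t - 1)\<close> and \<open>P(1 - 2 t)\<close> have the same leading coefficient,
  and the constant \<open>e\<close> does not affect it because \<open>n\<close> is positive.\<close>

lemma even_degree_reflection:
  fixes P :: "real poly"
  assumes deg: "degree P = n" and n: "even n" "n \<ge> 1"
    and eq: "\<And>t. 0 < t \<Longrightarrow> t < 1 \<Longrightarrow> a * poly P (2 * t - 1) + b * poly P (1 - 2 * t) + e = 0"
  shows "a + b = 0"
proof -
  let ?Q = "smult a (pcompose P [:-1, 2:]) + smult b (pcompose P [:1, -2:]) + [:e:]"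
  have "?Q = 0"
  proof (rule poly_zero_on_interval[of 0 1])
    fix t :: real assume "0 < t" "t < 1"
    then show "poly ?Q t = 0" using eq[of t] by (simp add: poly_pcompose algebra_simps)
  qed simp
  then have "coeff ?Q n = 0" by simp
  moreover have "coeff (pcompose P [:-1, 2:]) n = lead_coeff P * 2 ^ n"
    using lead_coeff_comp[of "[:-1, 2:]" P] by (simp add: degree_pcompose deg)
  moreover have "coeff (pcompose P [:1, -2:]) n = lead_coeff P * 2 ^ n"
    using lead_coeff_comp[of "[:1, -2:]" P] n(1) by (simp add: degree_pcompose deg)
  moreover have "coeff [:e:] n = 0" using n(2) by (cases n) auto
  ultimately have "(a + b) * (lead_coeff P * 2 ^ n) = 0" by (simp add: algebra_simps)
  moreover have "lead_coeff P \<noteq> 0" using deg n(2) by auto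
  ultimately show ?thesis by simp
qed

text \<open>On the edge from \<open>u\<close> to \<open>v\<close> the barycentric coordinates are \<open>1 - t\<close>, \<open>t\<close> and \<open>0\<close>, so the relation becomes
  one between \<open>P\<^sub>n(2 t - 1)\<close>, \<open>P\<^sub>n(1 - 2 t)\<close> and a constant, and \<open>d u + d v = 0\<close>. Three such equations make
  all \<open>d\<close> vanish.\<close>

lemma jacobi_shapes_independent_on_triangle:
  assumes K: "2 simplex K" and n: "even n" "n \<ge> 1"
    and eq: "\<And>x. x \<in> interior K \<Longrightarrow> e + (\<Sum>y | y extreme_point_of K. d y * jacobi_shape n K y x) = 0"
  shows "e = 0" "\<And>y. y extreme_point_of K \<Longrightarrow> d y = 0"
proof -
  let ?J = "jacobi_poly n 0 2"
  let ?g = "\<lambda>x. e + (\<Sum>y | y extreme_point_of K. d y * jacobi_shape n K y x)"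
  have cont: "continuous_on UNIV ?g"
    using poly2_le_continuous[OF jacobi_shape_poly2_le[OF K _ n(2)]] by (intro continuous_intros) auto
  have closed: "closed {x. ?g x = 0}"
    using continuous_closed_preimage_constant[OF cont closed_UNIV, of 0] by simp
  have "closure (interior K) \<subseteq> {x. ?g x = 0}" by (rule closure_minimal[OF _ closed]) (use eq in auto)
  moreover have "closure (interior K) = K"
    using convex_closure_interior[OF triangle_compact(2)[OF K] interior_triangle_nonempty[OF K]]
      closure_closed[OF compact_imp_closed[OF triangle_compact(1)[OF K]]] by simp
  ultimately have g0: "?g x = 0" if "x \<in> K" for x using that by auto
  have pair: "d u + d v = 0" if uv: "u extreme_point_of K" "v extreme_point_of K" "u \<noteq> v" for u v
  proof -
    obtain w where w: "K = convex hull {u, v, w}" "cross2 (v - u) (w - u) \<noteq> 0" using triangle_at_edge[OF K uv] .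
    note ne = triangle_affine_independent(2-4)[OF w(2)]
    have vert: "{y. y extreme_point_of K} = {u, v, w}" unfolding w(1) using extreme_points_triangle[OF w(2)] by blast
    then have we: "w extreme_point_of K" by blast
    have "d u * poly ?J (2 * t - 1) + d v * poly ?J (1 - 2 * t) + (e + d w * poly ?J 1) = 0" if t: "0 < t" "t < 1" for t
    proof -
      define x where "x = u + t *\<^sub>R (v - u)"
      have "x \<in> closed_segment u v"
        unfolding x_def using t by (auto simp: in_segment algebra_simps intro!: exI[of _ t])
      then have "x \<in> K" using segment_subset_triangle[OF K uv(1,2)] by blast
      have bary: "barycentric K u x = 1 - t" "barycentric K v x = t" "barycentric K w x = 0"
        unfolding x_def barycentric_on_edge[OF K uv(1)] barycentric_on_edge[OF K uv(2)] barycentric_on_edge[OF K we]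
        using barycentric_properties(2,3)[OF K uv(1)] barycentric_properties(2,3)[OF K uv(2)]
          barycentric_properties(3)[OF K we] uv ne by simp_all
      then have args: "1 - 2 * barycentric K u x = 2 * t - 1" "1 - 2 * barycentric K v x = 1 - 2 * t"
        "1 - 2 * barycentric K w x = 1" by simp_all
      show ?thesis using g0[OF \<open>x \<in> K\<close>] ne by (simp add: vert jacobi_shape_def args add_ac)
    qed
    then show ?thesis by (rule even_degree_reflection[OF degree_jacobi[OF n(2)] n])
  qed
  obtain a b c where abc: "K = convex hull {a, b, c}" "cross2 (b - a) (c - a) \<noteq> 0" using simplex_triangle[OF K] .
  have vert: "y extreme_point_of K \<longleftrightarrow> y = a \<or> y = b \<or> y = c" for y
    unfolding abc(1) extreme_points_triangle[OF abc(2)] by simp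
  have "d a + d b = 0" "d a + d c = 0" "d b + d c = 0"
    using pair vert triangle_affine_independent(2-4)[OF abc(2)] by blast+
  then have "d a = 0" "d b = 0" "d c = 0" by linarith+
  then show d0: "d y = 0" if "y extreme_point_of K" for y using that by (auto simp: vert)
  have "a \<in> K" using vert[of a] by (simp add: extreme_point_of_def)
  from g0[OF this] show "e = 0" using d0 by simp
qed

lemma finite_critical_points:
  assumes \<T>: "face_to_face \<T>" shows "finite (critical_points \<T> z)"
proof -
  have "critical_points \<T> z \<subseteq> (\<Union>K\<in>\<T>. {y. y extreme_point_of K})"
    by (auto simp: critical_points_def patch_vertices_def vertices_def)
  moreover have "finite (\<Union>K\<in>\<T>. {y. y extreme_point_of K})"
    using face_to_faceD(1,2)[OF \<T>] finite_extreme_points_triangle by blast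
  ultimately show ?thesis by (rule finite_subset)
qed

text \<open>On a single triangle only the critical functions of its vertices are nonzero, up to the common
  nonzero factor \<open>\<sigma> K / |K|\<close>; vertices that are not critical get the coefficient zero.\<close>

lemma critical_funs_coefficients_zero:
  assumes \<T>: "face_to_face \<T>" and \<sigma>: "admissible_signs \<T> z \<sigma>" and n: "even n" "n \<ge> 1"
    and ne: "patch \<T> z \<noteq> {}"
    and eq: "\<And>x. e * one_patch \<T> z x + (\<Sum>y\<in>critical_points \<T> z. d y * critical_fun \<T> z \<sigma> n y x) = 0"
  shows "e = 0" "\<And>y. y \<in> critical_points \<T> z \<Longrightarrow> d y = 0"
proof -
  note S = face_to_face_patch[OF \<T>, of z]
  let ?C = "critical_points \<T> z"
  have *: "e = 0 \<and> (\<forall>y\<in>?C. y \<in> K \<longrightarrow> d y = 0)" if K: "K \<in> patch \<T> z" for K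
  proof -
    note simp2 = face_to_faceD(2)[OF S K]
    let ?V = "{y. y extreme_point_of K}"
    let ?s = "\<sigma> K / measure lebesgue K"
    let ?d = "\<lambda>y. if y \<in> ?C then d y * ?s else 0"
    have s0: "?s \<noteq> 0" using \<sigma> K measure_triangle_pos[OF simp2] by (auto simp: admissible_signs_def)
    have inK: "y \<in> K \<longleftrightarrow> y \<in> ?V" if "y \<in> ?C" for y
      using critical_point_vertex[OF \<T> that K] by (auto simp: extreme_point_of_def)
    have "e + (\<Sum>y\<in>?V. ?d y * jacobi_shape n K y x) = 0" if x: "x \<in> interior K" for x
    proof -
      have "(\<Sum>y\<in>?C. d y * critical_fun \<T> z \<sigma> n y x) = (\<Sum>y\<in>?C. if y \<in> ?V then d y * ?s * jacobi_shape n K y x else 0)"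
        by (rule sum.cong[OF refl]) (simp add: critical_fun_interior[OF S K x] inK)
      also have "\<dots> = (\<Sum>y\<in>?C \<inter> ?V. d y * ?s * jacobi_shape n K y x)"
        by (rule sum.inter_restrict[symmetric, OF finite_critical_points[OF \<T>]])
      also have "\<dots> = (\<Sum>y\<in>?V \<inter> ?C. d y * ?s * jacobi_shape n K y x)" by (simp add: Int_commute)
      also have "\<dots> = (\<Sum>y\<in>?V. if y \<in> ?C then d y * ?s * jacobi_shape n K y x else 0)"
        by (rule sum.inter_restrict[OF finite_extreme_points_triangle[OF simp2]])
      also have "\<dots> = (\<Sum>y\<in>?V. ?d y * jacobi_shape n K y x)" by (rule sum.cong[OF refl]) simp
      finally show ?thesis using eq[of x] one_patch_interior[OF K x] by simp
    qed
    from jacobi_shapes_independent_on_triangle[OF simp2 n this]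
    have "e = 0" "\<And>y. y extreme_point_of K \<Longrightarrow> ?d y = 0" by blast+
    then show ?thesis using s0 inK by fastforce
  qed
  then show "e = 0" using ne by blast
  fix y assume y: "y \<in> ?C"
  then obtain K where "K \<in> patch \<T> z" "y \<in> K"
    by (auto simp: critical_points_def patch_vertices_def patch_region_def)
  then show "d y = 0" using * y by blast
qed

lemma sum_fun_apply: "(\<Sum>i\<in>I. f i) x = (\<Sum>i\<in>I. f i x :: real)"
  by (induction I rule: infinite_finite_induct) auto

text \<open>An indexed family is used so that distinctness of the functions follows from the vanishing of
  coefficients as well.\<close>

lemma independent_family:
  fixes b :: "'i \<Rightarrow> real^2 \<Rightarrow> real"
  assumes fin: "finite I"
    and coeffs: "\<And>c. (\<And>x. (\<Sum>i\<in>I. c i * b i x) = 0) \<Longrightarrow> \<forall>i\<in>I. c i = 0"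
  shows "inj_on b I" "fun_vs.independent (b ` I)"
proof -
  show inj: "inj_on b I"
  proof (rule inj_onI, rule ccontr)
    fix i j assume ij: "i \<in> I" "j \<in> I" "b i = b j" "i \<noteq> j"
    let ?c = "\<lambda>k. (if k = i then 1 else 0) - (if k = j then 1 else (0::real))"
    have "(\<Sum>k\<in>I. ?c k * b k x) = 0" for x
    proof -
      have "(\<Sum>k\<in>I. ?c k * b k x) = (\<Sum>k\<in>I. if k = i then b i x else 0) - (\<Sum>k\<in>I. if k = j then b j x else 0)"
        unfolding sum_subtractf[symmetric] by (rule sum.cong[OF refl]) simp
      then show ?thesis using ij fin by simp
    qed
    from coeffs[OF this] have "?c i = 0" using ij(1) by blast
    then show False using ij(4) by simp
  qed
  show "fun_vs.independent (b ` I)"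
  proof
    assume "fun_vs.dependent (b ` I)"
    then obtain u w where u: "w \<in> b ` I" "u w \<noteq> 0" "(\<Sum>w\<in>b ` I. (\<lambda>x. u w * w x)) = 0"
      using fun_vs.dependent_finite[of "b ` I"] fin by auto
    then obtain i where i: "i \<in> I" "u (b i) \<noteq> 0" by blast
    have "(\<Sum>i\<in>I. u (b i) * b i x) = 0" for x
      using fun_cong[OF u(3), of x] by (simp add: sum_fun_apply sum.reindex[OF inj])
    from coeffs[OF this] show False using i by blast
  qed
qed

theorem lemma3p13:
  fixes p :: nat and \<Omega> :: "(real^2) set" and \<T> :: "(real^2) set set"
    and z :: "real^2" and \<sigma> :: "(real^2) set \<Rightarrow> real"
  defines "q \<equiv> critical_fun \<T> z \<sigma> (p - 1)"
    and "C \<equiv> critical_points \<T> z"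
  assumes "p \<ge> 3" and "odd p"
    and "bounded \<Omega>" and "polygonal_domain \<Omega>"
    and "regular_triangulation \<T> \<Omega>"
    and "\<forall>K\<in>\<T>. \<exists>y\<in>inner_vertices \<T> \<Omega>. y extreme_point_of K"
    and "z \<in> inner_vertices \<T> \<Omega>"
    and "admissible_signs \<T> z \<sigma>"
  shows "inj_on q C \<and> one_patch \<T> z \<notin> q ` C \<and>
      fun_vs.independent (insert (one_patch \<T> z) (q ` C)) \<and>
      insert (one_patch \<T> z) (q ` C) \<subseteq> N_space \<T> z p \<and>
      (fun_vs.dim (N_space \<T> z p) = 1 + card C \<longrightarrow>
        fun_vs.independent (insert (one_patch \<T> z) (q ` C)) \<and>
        fun_vs.span (insert (one_patch \<T> z) (q ` C)) = N_space \<T> z p)"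
proof -
  have \<T>: "face_to_face \<T>" using regular_triangulation_face_to_face assms(7) .
  have finC: "finite C" unfolding C_def by (rule finite_critical_points[OF \<T>])
  obtain K where "K \<in> \<T>" "z extreme_point_of K"
    using assms(9) by (auto simp: inner_vertices_def vertices_def)
  then have ne: "patch \<T> z \<noteq> {}" by (auto simp: patch_def extreme_point_of_def)
  have n: "even (p - 1)" "p - 1 \<ge> 1" using assms(3,4) by auto
  \<comment> \<open>The index \<open>None\<close> stands for the constant function, \<open>Some y\<close> for the critical function of \<open>y\<close>.\<close>
  let ?I = "insert None (Some ` C)"
  let ?b = "case_option (one_patch \<T> z) q"
  have "\<forall>i\<in>?I. c i = 0" if c: "\<And>x. (\<Sum>i\<in>?I. c i * ?b i x) = 0" for c :: "(real^2) option \<Rightarrow> real"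
  proof -
    have "c None * one_patch \<T> z x + (\<Sum>y\<in>C. c (Some y) * q y x) = 0" for x
      using c[of x] finC by (simp add: sum.reindex)
    from critical_funs_coefficients_zero[OF \<T> assms(10) n ne this[unfolded q_def C_def]]
    show ?thesis by (auto simp: C_def)
  qed
  from independent_family[OF _ this] finC
  have inj: "inj_on ?b ?I" and ind: "fun_vs.independent (?b ` ?I)" by blast+
  have image: "?b ` ?I = insert (one_patch \<T> z) (q ` C)" by (simp add: image_image)
  have injq: "inj_on q C"
  proof (rule inj_onI)
    fix y y' assume "y \<in> C" "y' \<in> C" "q y = q y'"
    then show "y = y'" using inj_onD[OF inj, of "Some y" "Some y'"] by simp
  qed
  have one: "one_patch \<T> z \<notin> q ` C"
  proof
    assume "one_patch \<T> z \<in> q ` C"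
    then obtain y where "y \<in> C" "one_patch \<T> z = q y" by blast
    then show False using inj_onD[OF inj, of None "Some y"] by simp
  qed
  have sub: "insert (one_patch \<T> z) (q ` C) \<subseteq> N_space \<T> z p"
    using one_patch_in_N_space[OF \<T>] critical_fun_in_N_space[OF \<T> assms(10)] assms(3)
    by (auto simp: q_def C_def)
  have "card (insert (one_patch \<T> z) (q ` C)) = 1 + card C"
    using one finC by (simp add: card_image[OF injq])
  then have "fun_vs.span (insert (one_patch \<T> z) (q ` C)) = N_space \<T> z p"
    if "fun_vs.dim (N_space \<T> z p) = 1 + card C"
    using span_eq_of_card_dim[OF subspace_N_space[OF \<T>] ind[unfolded image] sub] that by simp
  with injq one ind sub show ?thesis unfolding image by blast
qed

end
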